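(* Assume the Setup and the Spectral notation, with parameters $\epsilon=\epsilon(n)$, $\delta=\delta(n)$ as there. Let $\mathcal T$ be a sample of $\mathbb P^H$ and $o\in V$ uniformly random, independent of $\mathcal T$. Then for every integer $r>0$: (1) $\lim_{t\to\infty}\limsup_{n\to\infty}\mathbb P(|B_{\mathcal T}(o,r)|>t)=0$; (2) $\lim_{n\to\infty}\mathbb P(B_{\mathcal T}(o,r)\text{ is a tree})=1$; (3) $\lim_{n\to\infty}\mathbb P(B_{\mathcal T}(o,r)\cap U_{\epsilon,\delta}\neq\emptyset)=0$.
   Context: Setup. $k\ge 1$ is a fixed integer and $d=d(n)$ is a sequence of positive integers with $d(n)\to\infty$. For each $n$, $G=G_n=(V,U,E)$ is a finite simple bipartite graph with parts $V=V_n$, $|V|=n$, and $U=U_n$, $|U|=m$, and edge set $E$, which is $C_4$-free (any two distinct vertices have at most one common neighbour) and $(d,k+1)$-bi-regular (every $v\in V$ has degree $d$ and every $u\in U$ has degree $k+1$). $B=B_n$ is a signed adjacency matrix of $G$: the real $V\times U$ matrix with $B_{v,u}\in\{1,-1\}$ if $vu\in E$ and $B_{v,u}=0$ otherwise. $H\subset\mathbb R^U$ is the row space of $B$ and $P_H$ the orthogonal projection onto $H$, viewed as a $U\times U$ matrix. The determinantal measure $\mathbb P^H$ is the probability measure on subsets $\mathcal S\subset U$ of size $\operatorname{rank}B$ given by $\mathbb P^H(\mathcal S)=\det(P_H|_{\mathcal S})$, where $P_H|_{\mathcal S}$ is the principal submatrix with rows and columns indexed by $\mathcal S$. For $\mathcal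 S\subset U$, $G[\mathcal S]$ denotes the subgraph of $G$ induced by $\mathcal S\cup N_G(\mathcal S)$. For $v\in V$ and an integer $r\ge 0$, $B_{\mathcal S}(v,r)$ denotes the rooted ball of radius $r$ around $v$ in $G[\mathcal S]$ (rooted at $v$; it is just $\{v\}$ if $v$ has no neighbour in $\mathcal S$). Spectral notation. $L^-=\frac1d B^TB$ (a $U\times U$ positive semidefinite matrix); $\lambda_1,\dots,\lambda_{\operatorname{rank}B}$ are its positive eigenvalues (with multiplicity) and $\psi_1,\dots,\psi_{\operatorname{rank}B}\in\mathbb R^U$ a corresponding orthonormal family of eigenvectors. For $\epsilon,\delta>0$, a vertex $u\in U$ is $(\epsilon,\delta)$-structured if $\sum_{i:(\lambda_i-1)^2>\epsilon}\psi_i(u)^2>\delta$, and $U_{\epsilon,\delta}$ is the set of such vertices. $I=\{i:(\lambda_i-1)^2\le\epsilon\}$ and $H_I=\operatorname{span}\{\psi_i:i\in I\}$; $\mathbb P^{H_I}$ is the determinantal measure $\mathbb P^{H_I}(\mathcal S)=\det(P_{H_I}|_{\mathcal S})$ on subsets of $U$ of size $|I|$. The parameters $\epsilon=\epsilon(n)>0$, $\delta=\delta(n)>0$ satisfy $\epsilon\to0$, $\epsilon d\to\infty$, $\delta d\to0$ and $\epsilon\delta d^2\to\infty$ as $n\to\infty$. *)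

theory Defs
  imports "HOL-Analysis.Analysis" "HOL-Library.Function_Algebras"
begin

interpretation fun_vs: vector_space "\<lambda>(c::real) (f::'a\<Rightarrow>real). (\<lambda>x. c * f x)"
  by unfold_locales (auto simp: fun_eq_iff algebra_simps)

definition ipU :: "'u set \<Rightarrow> ('u \<Rightarrow> real) \<Rightarrow> ('u \<Rightarrow> real) \<Rightarrow> real" where
  "ipU U x y = (\<Sum>u\<in>U. x u * y u)"

text \<open>Row space of a V x U matrix B (entries outside V x U are 0).\<close>
definition row_space :: "'v set \<Rightarrow> ('v \<Rightarrow> 'u \<Rightarrow> real) \<Rightarrow> ('u \<Rightarrow> real) set" where
  "row_space V B = fun_vs.span {(\<lambda>u. B v u) | v. v \<in> V}"

definition mat_rank :: "'v set \<Rightarrow> ('v \<Rightarrow> 'u \<Rightarrow> real) \<Rightarrow> nat" where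
  "mat_rank V B = fun_vs.dim (row_space V B)"

definition orth_proj :: "'u set \<Rightarrow> ('u \<Rightarrow> real) set \<Rightarrow> ('u \<Rightarrow> real) \<Rightarrow> ('u \<Rightarrow> real)" where
  "orth_proj U H y = (THE x. x \<in> H \<and> (\<forall>h\<in>H. ipU U (\<lambda>u. y u - x u) h = 0))"

definition proj_mat :: "'u set \<Rightarrow> ('u \<Rightarrow> real) set \<Rightarrow> 'u \<Rightarrow> 'u \<Rightarrow> real" where
  "proj_mat U H u w = orth_proj U H (\<lambda>z. if z = w then 1 else 0) u"

definition det_on :: "'u set \<Rightarrow> ('u \<Rightarrow> 'u \<Rightarrow> real) \<Rightarrow> real" where
  "det_on S M = (\<Sum>p\<in>{p. p permutes S}. of_int (sign p) * (\<Prod>i\<in>S. M i (p i)))"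

definition det_measure :: "'u set \<Rightarrow> ('u \<Rightarrow> real) set \<Rightarrow> 'u set \<Rightarrow> real" where
  "det_measure U H S = det_on S (proj_mat U H)"

text \<open>Probability of an event about (T, o), where T is a sample of P^H
  (H the row space of B, supported on subsets of U of size rank B) and
  o is uniform on V, independent of T.\<close>
definition sample_prob :: "'v set \<Rightarrow> 'u set \<Rightarrow> ('v \<Rightarrow> 'u \<Rightarrow> real)
    \<Rightarrow> ('u set \<Rightarrow> 'v \<Rightarrow> bool) \<Rightarrow> real" where
  "sample_prob V U B P =
     (1 / real (card V)) *
     (\<Sum>x0\<in>V. \<Sum>S\<in>{S. S \<subseteq> U \<and> card S = mat_rank V B}.
        det_measure U (row_space V B) S * (if P S x0 then 1 else 0))"

definition Lminus :: "'v set \<Rightarrow> ('v \<Rightarrow> 'u \<Rightarrow> real) \<Rightarrow> nat \<Rightarrow> 'u \<Rightarrow> 'u \<Rightarrow> real" where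
  "Lminus V B d u w = (1 / real d) * (\<Sum>v\<in>V. B v u * B v w)"

text \<open>The set U_{eps,delta} of (eps,delta)-structured vertices, for eigenvalues
  lam 0..rk-1 and eigenvectors psi 0..rk-1.\<close>
definition structured :: "'u set \<Rightarrow> nat \<Rightarrow> (nat \<Rightarrow> real) \<Rightarrow> (nat \<Rightarrow> 'u \<Rightarrow> real)
    \<Rightarrow> real \<Rightarrow> real \<Rightarrow> 'u set" where
  "structured U rk lam psi eps delta =
     {u \<in> U. (\<Sum>i\<in>{i. i < rk \<and> (lam i - 1)^2 > eps}. (psi i u)^2) > delta}"

text \<open>Adjacency of G[S] on vertex type 'v + 'u: edges of G (E a subset of V x U)
  whose U-endpoint lies in S (these are exactly the edges of the subgraph
  induced by S union N_G(S)).\<close>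
fun ind_adj :: "('v \<times> 'u) set \<Rightarrow> 'u set \<Rightarrow> ('v + 'u) \<Rightarrow> ('v + 'u) \<Rightarrow> bool" where
  "ind_adj E S (Inl v) (Inr u) = ((v, u) \<in> E \<and> u \<in> S)"
| "ind_adj E S (Inr u) (Inl v) = ((v, u) \<in> E \<and> u \<in> S)"
| "ind_adj E S _ _ = False"

definition ball_verts :: "('a \<Rightarrow> 'a \<Rightarrow> bool) \<Rightarrow> 'a \<Rightarrow> nat \<Rightarrow> 'a set" where
  "ball_verts adj x r = {y. \<exists>xs. xs \<noteq> [] \<and> hd xs = x \<and> last xs = y \<and>
                              length xs \<le> r + 1 \<and> successively adj xs}"

definition is_tree :: "'a set \<Rightarrow> ('a \<Rightarrow> 'a \<Rightarrow> bool) \<Rightarrow> bool" where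
  "is_tree W adj \<longleftrightarrow>
     (\<forall>x\<in>W. \<forall>y\<in>W. \<exists>xs. xs \<noteq> [] \<and> hd xs = x \<and> last xs = y \<and> set xs \<subseteq> W
                         \<and> successively adj xs) \<and>
     \<not> (\<exists>cs. distinct cs \<and> length cs \<ge> 3 \<and> set cs \<subseteq> W \<and> successively adj cs
            \<and> adj (last cs) (hd cs))"

end

theory Submission
  imports Defs
begin

text \<open>
  The kernel K of the projection onto the row space satisfies
  \<open>P(A \<subseteq> T) \<le> (\<Prod>u\<in>A. K u u)\<close>: conditioning on \<open>a \<in> T\<close> replaces K by its Schur complement at \<open>a\<close>,
  which is again a projection with smaller diagonal. Comparing the traces of \<open>L\<^sup>-\<close> and of its square with
  the rank gives \<open>(\<Sum>i. (\<lambda>\<^sub>i - 1)\<^sup>2) \<le> n k / d\<close>, so at most \<open>n k / (d \<epsilon>)\<close> eigenvalues deviate from 1 by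
  more than \<open>\<surd>\<epsilon>\<close>. Hence \<open>K u u = O(1/d)\<close> for every unstructured \<open>u\<close>, while the
  structured vertices carry total mass \<open>o(n)\<close>. The rest is a first moment count. Each vertex of V
  has d neighbours and each new vertex of U is retained with probability \<open>O(1/d)\<close>, so the expected
  number of retained paths of bounded length through unstructured vertices is bounded. Paths from \<open>o\<close>
  to a first structured vertex are counted backwards from their end and have expectation \<open>o(1)\<close>.
  A cycle in the ball forces the last vertex of U of some exploration of bounded length to meet the
  explored part twice; by \<open>C\<^sub>4\<close>-freeness this vertex has \<open>O(1)\<close> instead of \<open>O(d)\<close> choices, so such
  explorations have expectation \<open>O(1/d)\<close>.
\<close>

section \<open>Determinantal measures of projection kernels\<close>

lemma det_on_row_linear:
  assumes "finite S" "b \<in> S"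
  shows "det_on S (\<lambda>i j. if i = b then x j + c * y j else M i j) =
    det_on S (\<lambda>i j. if i = b then x j else M i j) + c * det_on S (\<lambda>i j. if i = b then y j else M i j)"
proof -
  have *: "(\<Prod>i\<in>S. if i = b then z (p i) else M i (p i)) = z (p b) * (\<Prod>i\<in>S - {b}. M i (p i))"
    for z :: "'a \<Rightarrow> real" and p
    using assms by (subst prod.remove[of S b]) (auto intro!: prod.cong)
  have "det_on S (\<lambda>i j. if i = b then z j else M i j) =
      (\<Sum>p\<in>{p. p permutes S}. of_int (sign p) * (z (p b) * (\<Prod>i\<in>S - {b}. M i (p i))))"
    for z :: "'a \<Rightarrow> real"
    unfolding det_on_def by (simp only: *)
  then show ?thesis
    by (simp add: sum.distrib sum_distrib_left algebra_simps)
qed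

text \<open>Composing every permutation with the transposition of \<open>a\<close> and
  \<open>b\<close> flips the sign and keeps the product, so the determinant equals its own
  negative.\<close>

lemma det_on_identical_rows:
  assumes "finite S" "a \<in> S" "b \<in> S" "a \<noteq> b" "\<And>j. M a j = M b j"
  shows "det_on S M = 0"
proof -
  let ?t = "Transposition.transpose a b"
  have t: "?t permutes S" using assms by (simp add: permutes_swap_id)
  have prod: "(\<Prod>i\<in>S. M i ((p \<circ> ?t) i)) = (\<Prod>i\<in>S. M i (p i))" for p
  proof -
    have "(\<Prod>i\<in>S. M i ((p \<circ> ?t) i)) = (\<Prod>i\<in>S. M (?t i) (p i))"
      by (rule prod.reindex_bij_witness[of S ?t ?t])
        (use t in \<open>auto simp: permutes_in_image\<close>)
    also have "\<dots> = (\<Prod>i\<in>S. M i (p i))"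
      by (rule prod.cong) (use assms(5) in \<open>auto simp: Transposition.transpose_def\<close>)
    finally show ?thesis .
  qed
  have "det_on S M = (\<Sum>p\<in>{p. p permutes S}. of_int (sign (p \<circ> ?t)) * (\<Prod>i\<in>S. M i ((p \<circ> ?t) i)))"
    unfolding det_on_def using sum_permutations_compose_right[OF t] .
  also have "\<dots> = (\<Sum>p\<in>{p. p permutes S}. - (of_int (sign p) * (\<Prod>i\<in>S. M i (p i))))"
  proof (rule sum.cong[OF refl])
    fix p assume "p \<in> {p. p permutes S}"
    then have "permutation p" using assms(1) by (auto simp: permutation_permutes)
    then have "sign (p \<circ> ?t) = - sign p"
      using assms(4) by (simp add: sign_compose permutation_swap_id sign_swap_id)
    then show "real_of_int (sign (p \<circ> ?t)) * (\<Prod>i\<in>S. M i ((p \<circ> ?t) i)) =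
        - (real_of_int (sign p) * (\<Prod>i\<in>S. M i (p i)))"
      by (simp add: prod del: o_apply)
  qed
  also have "\<dots> = - det_on S M" by (simp add: det_on_def sum_negf)
  finally show ?thesis by simp
qed

text \<open>One row is changed at a time: linearity in that row leaves an error term in which it
  coincides with the pivot row \<open>a\<close>. The pivot itself stays fixed because
  \<open>R\<close> avoids \<open>a\<close>.\<close>

lemma det_on_row_operations:
  assumes "finite S" "a \<in> S" "finite R" "R \<subseteq> S - {a}"
  shows "det_on S (\<lambda>i j. if i \<in> R then M i j + c i * M a j else M i j) = det_on S M"
  using assms(3,4)
proof (induction R rule: finite_induct)
  case (insert b R)
  let ?M = "\<lambda>i j. if i \<in> R then M i j + c i * M a j else M i j"
  have "a \<noteq> b" "b \<in> S" "a \<notin> R" "b \<notin> R" using insert by auto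
  have "det_on S (\<lambda>i j. if i \<in> insert b R then M i j + c i * M a j else M i j) =
      det_on S (\<lambda>i j. if i = b then M b j + c b * M a j else ?M i j)"
    by (rule arg_cong[where f = "det_on S"]) (auto simp: fun_eq_iff)
  also have "\<dots> = det_on S (\<lambda>i j. if i = b then M b j else ?M i j) +
      c b * det_on S (\<lambda>i j. if i = b then M a j else ?M i j)"
    using assms(1) \<open>b \<in> S\<close> by (rule det_on_row_linear)
  also have "det_on S (\<lambda>i j. if i = b then M a j else ?M i j) = 0"
    using assms(1) assms(2) \<open>b \<in> S\<close> \<open>a \<noteq> b\<close>
    by (rule det_on_identical_rows) (use \<open>a \<notin> R\<close> in auto)
  also have "(\<lambda>i j. if i = b then M b j else ?M i j) = ?M"
    using \<open>b \<notin> R\<close> by (auto simp: fun_eq_iff)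
  finally show ?case using insert by simp
qed simp

text \<open>A permutation of \<open>insert a S\<close> that moves \<open>a\<close> must send some
  element of \<open>S\<close> to \<open>a\<close> and so picks up a zero of column \<open>a\<close>.
  What survives are the permutations of \<open>S\<close>.\<close>

lemma det_on_zero_column:
  assumes "finite S" "a \<notin> S" "\<And>i. i \<in> S \<Longrightarrow> M i a = 0"
  shows "det_on (insert a S) M = M a a * det_on S M"
proof -
  let ?f = "\<lambda>p. of_int (sign p) * (\<Prod>i\<in>insert a S. M i (p i))"
  have sub: "{p. p permutes S} \<subseteq> {p. p permutes insert a S}"
    by (auto intro: permutes_subset)
  have "det_on (insert a S) M = (\<Sum>p\<in>{p. p permutes S}. ?f p)"
    unfolding det_on_def
  proof (rule sum.mono_neutral_right)
    show "finite {p. p permutes insert a S}" using assms by (intro finite_permutations) auto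
    show "\<forall>p\<in>{p. p permutes insert a S} - {p. p permutes S}. ?f p = 0"
    proof
      fix p assume "p \<in> {p. p permutes insert a S} - {p. p permutes S}"
      then have p: "p permutes insert a S" "\<not> p permutes S" by auto
      have "p a \<noteq> a"
        using p permutes_superset[of p "insert a S" S] by auto
      moreover obtain i where i: "p i = a" using p(1) by (metis permutes_surj surjD)
      ultimately have "i \<in> insert a S" "i \<noteq> a"
        using p(1) by (auto simp: permutes_def)
      then have "i \<in> S" "M i (p i) = 0" using assms i by auto
      then show "?f p = 0" using assms(1) by (auto simp: prod_zero_iff)
    qed
  qed (use sub in auto)
  also have "\<dots> = (\<Sum>p\<in>{p. p permutes S}. M a a * (of_int (sign p) * (\<Prod>i\<in>S. M i (p i))))"
    using assms by (intro sum.cong) (auto simp: permutes_not_in)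
  finally show ?thesis by (simp add: det_on_def sum_distrib_left)
qed

lemma det_on_cong:
  assumes "\<And>i j. i \<in> S \<Longrightarrow> j \<in> S \<Longrightarrow> M i j = M' i j"
  shows "det_on S M = det_on S M'"
  unfolding det_on_def using assms
  by (intro sum.cong refl arg_cong2[where f = "(*)"] prod.cong) (auto simp: permutes_in_image)

text \<open>Kept as a matrix on the full index set: for a nonzero pivot, row and column
  \<open>a\<close> become zero instead of being deleted. For a zero pivot, division by zero returns
  \<open>M\<close> unchanged.\<close>

definition schur :: "'u \<Rightarrow> ('u \<Rightarrow> 'u \<Rightarrow> real) \<Rightarrow> 'u \<Rightarrow> 'u \<Rightarrow> real" where
  "schur a M = (\<lambda>i j. M i j - M i a * M a j / M a a)"

text \<open>One step of Gaussian elimination with pivot \<open>a\<close>: clear column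
  \<open>a\<close> by row operations, then expand along it.\<close>

lemma det_on_schur:
  assumes "finite S" "a \<notin> S" "M a a \<noteq> 0"
  shows "det_on (insert a S) M = M a a * det_on S (schur a M)"
proof -
  let ?M = "\<lambda>i j. if i \<in> S then M i j + (- M i a / M a a) * M a j else M i j"
  have "det_on (insert a S) M = det_on (insert a S) ?M"
    by (rule det_on_row_operations[symmetric]) (use assms in auto)
  also have "\<dots> = ?M a a * det_on S ?M"
    by (rule det_on_zero_column) (use assms in auto)
  also have "det_on S ?M = det_on S (schur a M)"
    by (rule det_on_cong) (simp add: schur_def)
  finally show ?thesis using assms by simp
qed

lemma det_on_zero_row:
  assumes "finite S" "a \<in> S" "\<And>j. j \<in> S \<Longrightarrow> M a j = 0"
  shows "det_on S M = 0"
  unfolding det_on_def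
proof (intro sum.neutral ballI)
  fix p assume "p \<in> {p. p permutes S}"
  then have "M a (p a) = 0" using assms by (simp add: permutes_in_image)
  then show "of_int (sign p) * (\<Prod>i\<in>S. M i (p i)) = 0" using assms by auto
qed

section \<open>Projection kernels and their Schur complements\<close>

definition proj_kernel :: "'u set \<Rightarrow> ('u \<Rightarrow> 'u \<Rightarrow> real) \<Rightarrow> bool" where
  "proj_kernel U K \<longleftrightarrow> (\<forall>u\<in>U. \<forall>w\<in>U. K u w = K w u \<and> (\<Sum>z\<in>U. K u z * K z w) = K u w)"

text \<open>Idempotence and symmetry make a diagonal entry the squared norm of its row. Hence it is
  nonnegative, and a zero on the diagonal annihilates the whole row.\<close>

lemma proj_kernel_diag:
  assumes "finite U" "proj_kernel U K" "a \<in> U"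
  shows "K a a = (\<Sum>z\<in>U. (K a z)\<^sup>2)"
proof -
  have "K a a = (\<Sum>z\<in>U. K a z * K z a)" using assms unfolding proj_kernel_def by metis
  also have "\<dots> = (\<Sum>z\<in>U. (K a z)\<^sup>2)"
    using assms by (intro sum.cong) (auto simp: proj_kernel_def power2_eq_square)
  finally show ?thesis .
qed

lemma proj_kernel_diag_nonneg:
  assumes "finite U" "proj_kernel U K" "a \<in> U"
  shows "K a a \<ge> 0"
  unfolding proj_kernel_diag[OF assms] by (intro sum_nonneg) auto

lemma proj_kernel_diag_zero:
  assumes "finite U" "proj_kernel U K" "a \<in> U" "K a a = 0" "z \<in> U"
  shows "K a z = 0"
  using proj_kernel_diag[OF assms(1-3)] assms by (auto simp: sum_nonneg_eq_0_iff)

lemma det_on_proj_kernel_zero_diag: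
  assumes "finite U" "proj_kernel U K" "a \<in> S" "S \<subseteq> U" "K a a = 0"
  shows "det_on S K = 0"
proof (rule det_on_zero_row[of S a])
  show "finite S" using assms(1,4) by (rule finite_subset[rotated])
  show "K a j = 0" if "j \<in> S" for j
    using proj_kernel_diag_zero[OF assms(1,2) _ assms(5)] assms(3,4) that by blast
qed fact

text \<open>Geometrically, the Schur complement projects onto those vectors of the range of
  \<open>K\<close> that vanish at \<open>a\<close>. The proof is the direct computation of its
  square.\<close>

lemma proj_kernel_schur:
  assumes "finite U" "proj_kernel U K" "a \<in> U" "K a a \<noteq> 0"
  shows "proj_kernel U (schur a K)"
  unfolding proj_kernel_def
proof (intro ballI conjI)
  fix u w assume uw: "u \<in> U" "w \<in> U"
  have sym: "K x y = K y x" and idem: "(\<Sum>z\<in>U. K x z * K z y) = K x y" if "x \<in> U" "y \<in> U" for x y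
    using assms(2) that unfolding proj_kernel_def by blast+
  show "schur a K u w = schur a K w u"
    using uw assms by (simp add: schur_def sym mult.commute)
  \<comment> \<open>The product is expanded into four terms, each a constant times a product of two
    entries of \<open>K\<close> that idempotence sums over \<open>z\<close>.\<close>
  have "schur a K u z * schur a K z w = K u z * K z w - K a w / K a a * (K u z * K z a)
      - K u a / K a a * (K a z * K z w) + K u a * K a w / (K a a * K a a) * (K a z * K z a)" for z
    using assms(4) by (simp add: schur_def field_simps)
  then have "(\<Sum>z\<in>U. schur a K u z * schur a K z w) =
     (\<Sum>z\<in>U. K u z * K z w) - K a w / K a a * (\<Sum>z\<in>U. K u z * K z a)
     - K u a / K a a * (\<Sum>z\<in>U. K a z * K z w)
     + K u a * K a w / (K a a * K a a) * (\<Sum>z\<in>U. K a z * K z a)"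
    by (simp only: sum.distrib sum_subtractf sum_distrib_left)
  also have "\<dots> = schur a K u w"
    using uw assms by (simp add: idem schur_def)
  finally show "(\<Sum>z\<in>U. schur a K u z * schur a K z w) = schur a K u w" .
qed

text \<open>The subtracted matrix has rank one and, by \<open>proj_kernel_diag\<close>, trace 1.
  Conditioning thus lowers the rank, and with it the sample size, by one.\<close>

lemma schur_trace:
  assumes "finite U" "proj_kernel U K" "a \<in> U" "K a a \<noteq> 0"
  shows "(\<Sum>u\<in>U. schur a K u u) = (\<Sum>u\<in>U. K u u) - 1"
proof -
  have "(\<Sum>u\<in>U. K u a * K a u) = (\<Sum>u\<in>U. (K a u)\<^sup>2)"
    using assms by (intro sum.cong) (auto simp: proj_kernel_def power2_eq_square)
  then have "(\<Sum>u\<in>U. K u a * K a u / K a a) = 1"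
    using assms proj_kernel_diag[OF assms(1-3)] by (simp flip: sum_divide_distrib)
  then show ?thesis by (simp add: schur_def sum_subtractf)
qed

text \<open>By symmetry the subtracted term is a square divided by a nonnegative number. This is the
  negative dependence behind the product bound on inclusion probabilities.\<close>

lemma schur_diag_le:
  assumes "finite U" "proj_kernel U K" "a \<in> U" "u \<in> U"
  shows "schur a K u u \<le> K u u"
proof -
  have "K u a = K a u" using assms by (auto simp: proj_kernel_def)
  then have "K u a * K a u / K a a = (K a u)\<^sup>2 / K a a" by (simp add: power2_eq_square)
  also have "\<dots> \<ge> 0" using proj_kernel_diag_nonneg[OF assms(1-3)] by simp
  finally show ?thesis by (simp add: schur_def)
qed

text \<open>Peel off one index at a time: a nonzero pivot contributes a nonnegative factor and
  leaves another projection kernel, and a zero pivot makes the determinant vanish.\<close>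

lemma det_on_nonneg:
  assumes "finite S" "finite U" "S \<subseteq> U" "proj_kernel U K"
  shows "det_on S K \<ge> 0"
  using assms
proof (induction S arbitrary: K rule: finite_induct)
  case empty
  then show ?case by (simp add: det_on_def)
next
  case (insert a S)
  show ?case
  proof (cases "K a a = 0")
    case True
    then have "det_on (insert a S) K = 0"
      using insert.prems by (intro det_on_proj_kernel_zero_diag[of U K a]) auto
    then show ?thesis by simp
  next
    case False
    then show ?thesis
      using insert proj_kernel_schur[of U K a] proj_kernel_diag_nonneg[of U K a]
      by (simp add: det_on_schur)
  qed
qed

text \<open>This is conditioning on \<open>a\<close>: removing \<open>a\<close> from each set turns
  the measure of \<open>K\<close> on sets of size \<open>Suc N\<close> into \<open>K a a\<close>
  times that of the Schur complement on sets of size \<open>N\<close>.\<close>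

lemma sum_det_on_containing:
  assumes "finite U" "proj_kernel U K" "a \<in> U" "K a a \<noteq> 0" "a \<notin> A"
  shows "(\<Sum>S | S \<subseteq> U \<and> card S = Suc N \<and> insert a A \<subseteq> S. det_on S K) =
    K a a * (\<Sum>S | S \<subseteq> U \<and> card S = N \<and> A \<subseteq> S. det_on S (schur a K))"
proof -
  have fin: "finite S" if "S \<subseteq> U" for S using assms(1) that by (rule finite_subset[rotated])
  \<comment> \<open>Sets containing \<open>a\<close> drop out since row \<open>a\<close> of the
    Schur complement is zero.\<close>
  have "(\<Sum>S | S \<subseteq> U \<and> card S = N \<and> A \<subseteq> S. det_on S (schur a K)) =
      (\<Sum>S | S \<subseteq> U \<and> card S = N \<and> A \<subseteq> S \<and> a \<notin> S. det_on S (schur a K))"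
    by (rule sum.mono_neutral_right)
      (use assms fin in \<open>auto simp: schur_def intro!: det_on_zero_row[of _ a]\<close>)
  moreover have "(\<Sum>S | S \<subseteq> U \<and> card S = Suc N \<and> insert a A \<subseteq> S. det_on S K) =
      (\<Sum>S | S \<subseteq> U \<and> card S = N \<and> A \<subseteq> S \<and> a \<notin> S. K a a * det_on S (schur a K))"
  proof (rule sum.reindex_bij_witness[of _ "insert a" "\<lambda>S. S - {a}"])
    fix S assume S: "S \<in> {S. S \<subseteq> U \<and> card S = Suc N \<and> insert a A \<subseteq> S}"
    then show "insert a (S - {a}) = S" by auto
    from S fin show "S - {a} \<in> {S. S \<subseteq> U \<and> card S = N \<and> A \<subseteq> S \<and> a \<notin> S}"
      using assms by auto
    have "det_on (insert a (S - {a})) K = K a a * det_on (S - {a}) (schur a K)"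
      using assms fin[of S] S by (intro det_on_schur) auto
    with \<open>insert a (S - {a}) = S\<close>
    show "K a a * det_on (S - {a}) (schur a K) = det_on S K" by simp
  qed (use assms fin in auto)
  ultimately show ?thesis by (simp add: sum_distrib_left)
qed

text \<open>Double counting of pairs of a set and one of its elements. By induction the sets
  containing \<open>a\<close> have total mass \<open>K a a\<close>, these masses add up to the trace
  \<open>Suc N\<close>, and each set is counted \<open>Suc N\<close> times.\<close>

lemma sum_det_on_eq_1:
  assumes "finite U" "proj_kernel U K" "(\<Sum>u\<in>U. K u u) = real N"
  shows "(\<Sum>S | S \<subseteq> U \<and> card S = N. det_on S K) = 1"
  using assms(2,3)
proof (induction N arbitrary: K)
  case 0
  have "{S. S \<subseteq> U \<and> card S = 0} = {{}}"
    using assms(1) by (auto dest: finite_subset)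
  then show ?case by (simp add: det_on_def)
next
  case (Suc N)
  have step: "(\<Sum>S | S \<subseteq> U \<and> card S = Suc N \<and> a \<in> S. det_on S K) = K a a" if "a \<in> U" for a
  proof (cases "K a a = 0")
    case True
    then show ?thesis using assms(1) Suc.prems that
      by (auto intro!: sum.neutral det_on_proj_kernel_zero_diag[of U K a])
  next
    case False
    then have "(\<Sum>S | S \<subseteq> U \<and> card S = N. det_on S (schur a K)) = 1"
      using assms(1) Suc that by (intro Suc.IH proj_kernel_schur) (auto simp: schur_trace)
    then show ?thesis
      using sum_det_on_containing[OF assms(1) Suc.prems(1) that False, of "{}" N] by simp
  qed
  have "real (Suc N) * (\<Sum>S | S \<subseteq> U \<and> card S = Suc N. det_on S K) =
      (\<Sum>S | S \<subseteq> U \<and> card S = Suc N. \<Sum>a\<in>U. if a \<in> S then det_on S K else 0)"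
    unfolding sum_distrib_left
  proof (rule sum.cong)
    fix S assume "S \<in> {S. S \<subseteq> U \<and> card S = Suc N}"
    then have "U \<inter> S = S" "card S = Suc N" by auto
    then show "real (Suc N) * det_on S K = (\<Sum>a\<in>U. if a \<in> S then det_on S K else 0)"
      using assms(1) by (simp flip: sum.inter_restrict)
  qed simp
  also have "\<dots> = (\<Sum>a\<in>U. \<Sum>S | S \<subseteq> U \<and> card S = Suc N. if a \<in> S then det_on S K else 0)"
    by (rule sum.swap)
  also have "\<dots> = (\<Sum>a\<in>U. \<Sum>S | S \<subseteq> U \<and> card S = Suc N \<and> a \<in> S. det_on S K)"
    using assms(1) by (simp add: conj_assoc flip: sum.inter_filter)
  also have "\<dots> = real (Suc N)" using step Suc.prems by simp
  finally show ?case by simp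
qed

text \<open>Conditioning on the elements of \<open>A\<close> one after another contributes a
  diagonal entry each time, and by \<open>schur_diag_le\<close> these entries only decrease along
  the way.\<close>

lemma sum_det_on_superset_le:
  assumes "finite A" "finite U" "proj_kernel U K" "(\<Sum>u\<in>U. K u u) = real N" "A \<subseteq> U"
  shows "(\<Sum>S | S \<subseteq> U \<and> card S = N \<and> A \<subseteq> S. det_on S K) \<le> (\<Prod>u\<in>A. K u u)"
  using assms(1,3-)
proof (induction A arbitrary: K N rule: finite_induct)
  case empty
  then show ?case using assms(2) by (simp add: sum_det_on_eq_1)
next
  case (insert a A)
  have a: "a \<in> U" and nonneg: "\<And>u. u \<in> U \<Longrightarrow> K u u \<ge> 0"
    using insert.prems assms(2) by (auto intro: proj_kernel_diag_nonneg)
  show ?case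
  proof (cases "K a a = 0")
    case True
    have "det_on S K = 0" if "S \<subseteq> U" "a \<in> S" for S
      using assms(2) insert.prems(1) a True that
      by (intro det_on_proj_kernel_zero_diag[of U K a]) auto
    then show ?thesis using True insert by (auto intro!: eq_refl sum.neutral)
  next
    case False
    \<comment> \<open>A positive diagonal entry bounded by the trace forces \<open>N\<close> to be a
      successor, so that one element can be removed.\<close>
    have "K a a \<le> real N"
      unfolding insert.prems(2)[symmetric] using assms(2) a nonneg by (intro member_le_sum) auto
    with False nonneg[OF a] obtain M where N: "N = Suc M" by (cases N) auto
    have "(\<Sum>S | S \<subseteq> U \<and> card S = M \<and> A \<subseteq> S. det_on S (schur a K)) \<le> (\<Prod>u\<in>A. schur a K u u)"
      using assms(2) a False insert.prems N
      by (intro insert.IH proj_kernel_schur) (auto simp: schur_trace)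
    also have "\<dots> \<le> (\<Prod>u\<in>A. K u u)"
      using assms(2) a False insert.prems
      by (intro prod_mono conjI schur_diag_le[of U] proj_kernel_diag_nonneg[of U] proj_kernel_schur) auto
    finally show ?thesis
      using sum_det_on_containing[OF assms(2) insert.prems(1) a False insert.hyps(2), of M] insert.hyps nonneg[OF a]
      by (simp add: N mult_left_mono)
  qed
qed

section \<open>The spectrum of a signed biregular graph\<close>

lemma sum_fun_eval: "(\<Sum>a\<in>A. f a) x = (\<Sum>a\<in>A. f a x :: real)"
  by (induction A rule: infinite_finite_induct) auto

lemma ipU_commute: "ipU U x y = ipU U y x"
  by (simp add: ipU_def mult.commute)

lemma ipU_sum_left: "ipU U (\<lambda>u. \<Sum>i\<in>I. c i * f i u) y = (\<Sum>i\<in>I. c i * ipU U (f i) y)"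
  unfolding ipU_def sum_distrib_left sum_distrib_right
  by (subst sum.swap) (simp add: mult.assoc)

lemma orthonormal_independent:
  fixes f :: "nat \<Rightarrow> 'u \<Rightarrow> real"
  assumes orth: "\<And>i j. i < N \<Longrightarrow> j < N \<Longrightarrow> ipU U (f i) (f j) = (if i = j then 1 else 0)"
  shows "inj_on f {..<N}" "\<not> fun_vs.dependent (f ` {..<N})"
proof -
  show inj: "inj_on f {..<N}"
    by (intro inj_onI) (metis lessThan_iff orth zero_neq_one)
  show "\<not> fun_vs.dependent (f ` {..<N})"
  proof (rule fun_vs.independent_if_scalars_zero)
    fix c q assume "(\<Sum>x\<in>f ` {..<N}. (\<lambda>u. c x * x u)) = 0" and "q \<in> f ` {..<N}"
    then obtain j where j: "j < N" "q = f j" and "(\<Sum>i<N. (\<lambda>u. c (f i) * f i u)) = 0"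
      by (auto simp: sum.reindex[OF inj])
    then have "(\<lambda>u. \<Sum>i<N. c (f i) * f i u) = (\<lambda>_. 0)"
      by (metis (mono_tags, lifting) ext sum_fun_eval zero_fun_apply sum.cong)
    then have "0 = ipU U (\<lambda>u. \<Sum>i<N. c (f i) * f i u) (f j)"
      by (simp add: ipU_def)
    also have "\<dots> = (\<Sum>i<N. if i = j then c (f i) else 0)"
      unfolding ipU_sum_left using orth j by (intro sum.cong) auto
    finally show "c q = 0" using j by simp
  qed simp
qed

text \<open>A dimension count: an \<open>h\<close> outside the span of the \<open>f i\<close> would
  give \<open>N + 1\<close> independent vectors in a space of dimension \<open>N\<close>. The
  coefficients are then read off by pairing with each \<open>f j\<close>. The identity holds at
  every \<open>u\<close>, also outside \<open>U\<close>.\<close>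

lemma orthonormal_basis_expansion:
  fixes f :: "nat \<Rightarrow> 'u \<Rightarrow> real"
  assumes orth: "\<And>i j. i < N \<Longrightarrow> j < N \<Longrightarrow> ipU U (f i) (f j) = (if i = j then 1 else 0)"
    and X: "finite X" "H = fun_vs.span X" "fun_vs.dim H = N"
    and f: "\<And>i. i < N \<Longrightarrow> f i \<in> H" and h: "h \<in> H"
  shows "h u = (\<Sum>i<N. ipU U h (f i) * f i u)"
proof -
  note inj = orthonormal_independent(1)[of N U f, OF orth]
    and indep = orthonormal_independent(2)[of N U f, OF orth]
  obtain b where b: "b \<subseteq> H" "\<not> fun_vs.dependent b" "H \<subseteq> fun_vs.span b" "card b = N"
    using fun_vs.basis_exists[of H] X by metis
  have fb: "finite b"
    using fun_vs.independent_span_bound[of X b] X b by auto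
  have "h \<in> fun_vs.span (f ` {..<N})"
  proof (rule ccontr)
    assume not_in: "h \<notin> fun_vs.span (f ` {..<N})"
    then have "\<not> fun_vs.dependent (insert h (f ` {..<N}))"
      using indep by (rule fun_vs.independent_insertI)
    moreover have "insert h (f ` {..<N}) \<subseteq> fun_vs.span b" using b h f by auto
    ultimately have "card (insert h (f ` {..<N})) \<le> N"
      using fun_vs.independent_span_bound[OF fb] b by metis
    moreover have "h \<notin> f ` {..<N}" using not_in fun_vs.span_base[of h "f ` {..<N}"] by metis
    ultimately show False using inj by (simp add: card_image)
  qed
  then obtain c where "h = (\<Sum>x\<in>f ` {..<N}. (\<lambda>u. c x * x u))"
    by (auto simp: fun_vs.span_finite)
  then have c: "h = (\<lambda>u. \<Sum>i<N. c (f i) * f i u)"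
    by (simp add: sum.reindex[OF inj] fun_eq_iff sum_fun_eval)
  have "ipU U h (f j) = c (f j)" if "j < N" for j
  proof -
    have "ipU U h (f j) = (\<Sum>i<N. if i = j then c (f i) else 0)"
      unfolding c ipU_sum_left using orth that by (intro sum.cong) auto
    then show ?thesis using that by simp
  qed
  then show ?thesis by (simp add: c)
qed

section \<open>Signed biregular graphs and the spectral form of the projection\<close>

locale signed_biregular =
  fixes k d :: nat and V :: "'v set" and U :: "'u set" and E :: "('v \<times> 'u) set"
    and B :: "'v \<Rightarrow> 'u \<Rightarrow> real"
  assumes d_pos: "d > 0"
    and fin_V: "finite V" and fin_U: "finite U" and E_sub: "E \<subseteq> V \<times> U"
    and deg_V: "\<And>v. v \<in> V \<Longrightarrow> card {u. (v, u) \<in> E} = d"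
    and deg_U: "\<And>u. u \<in> U \<Longrightarrow> card {v. (v, u) \<in> E} = k + 1"
    and C4_V: "\<And>v v'. v \<in> V \<Longrightarrow> v' \<in> V \<Longrightarrow> v \<noteq> v' \<Longrightarrow> card {u. (v, u) \<in> E \<and> (v', u) \<in> E} \<le> 1"
    and C4_U: "\<And>u u'. u \<in> U \<Longrightarrow> u' \<in> U \<Longrightarrow> u \<noteq> u' \<Longrightarrow> card {v. (v, u) \<in> E \<and> (v, u') \<in> E} \<le> 1"
    and B_signed: "\<And>v u. if (v, u) \<in> E then B v u \<in> {1, -1} else B v u = 0"

locale signed_biregular_eig = signed_biregular k d V U E B
  for k d :: nat and V :: "'v set" and U :: "'u set" and E :: "('v \<times> 'u) set"
    and B :: "'v \<Rightarrow> 'u \<Rightarrow> real" +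
  fixes lam :: "nat \<Rightarrow> real" and psi :: "nat \<Rightarrow> 'u \<Rightarrow> real"
  assumes eig_pos: "\<And>i. i < mat_rank V B \<Longrightarrow> lam i > 0"
    and eig_vec: "\<And>i u. i < mat_rank V B \<Longrightarrow> u \<in> U \<Longrightarrow>
      (\<Sum>w\<in>U. Lminus V B d u w * psi i w) = lam i * psi i u"
    and eig_orth: "\<And>i j. i < mat_rank V B \<Longrightarrow> j < mat_rank V B \<Longrightarrow>
      ipU U (psi i) (psi j) = (if i = j then 1 else 0)"
begin

abbreviation "rk \<equiv> mat_rank V B"
abbreviation "H \<equiv> row_space V B"
abbreviation "K \<equiv> proj_mat U H"

text \<open>The values of \<open>psi i\<close> off \<open>U\<close> are unconstrained, whereas
  vectors of the row space vanish there. Only the truncation is literally a member of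
  \<open>H\<close>.\<close>

definition psi0 :: "nat \<Rightarrow> 'u \<Rightarrow> real" where
  "psi0 i u = (if u \<in> U then psi i u else 0)"

lemma psi0_orth:
  "i < rk \<Longrightarrow> j < rk \<Longrightarrow> ipU U (psi0 i) (psi0 j) = (if i = j then 1 else 0)"
  using eig_orth[of i j] by (simp add: ipU_def psi0_def)

lemma ipU_psi0: "ipU U x (psi0 i) = ipU U x (psi i)"
  by (simp add: ipU_def psi0_def)

lemma B_outside: "u \<notin> U \<Longrightarrow> B v u = 0"
  using B_signed[of v u] E_sub by (auto split: if_splits)

lemma B_abs: "\<bar>B v u\<bar> = (if (v, u) \<in> E then 1 else 0)"
  using B_signed[of v u] by (auto split: if_splits)

lemma B_square: "B v u * B v u = (if (v, u) \<in> E then 1 else 0)"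
  using B_signed[of v u] by (auto split: if_splits)

lemma row_in_H: "v \<in> V \<Longrightarrow> (\<lambda>u. B v u) \<in> H"
  unfolding row_space_def by (rule fun_vs.span_base) auto

lemma sum_scale_in_H:
  assumes "\<And>i. i \<in> I \<Longrightarrow> f i \<in> H"
  shows "(\<lambda>u. \<Sum>i\<in>I. c i * f i u) \<in> H"
proof -
  have "(\<Sum>i\<in>I. (\<lambda>u. c i * f i u)) \<in> H"
    using assms unfolding row_space_def by (intro fun_vs.span_sum fun_vs.span_scale) auto
  then show ?thesis by (metis (no_types, lifting) ext sum.cong sum_fun_eval)
qed

lemma Lminus_in_H: "(\<lambda>w. Lminus V B d u w) \<in> H"
proof -
  have "(\<lambda>w. \<Sum>v\<in>V. (B v u / d) * B v w) \<in> H"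
    by (rule sum_scale_in_H) (rule row_in_H)
  then show ?thesis by (simp add: Lminus_def sum_distrib_left)
qed

lemma Lminus_sym: "Lminus V B d u w = Lminus V B d w u"
  by (simp add: Lminus_def mult.commute)

text \<open>An eigenvector with nonzero eigenvalue is a combination of the rows of its matrix, and
  the rows of \<open>Lminus\<close> are combinations of the rows of \<open>B\<close>. Off
  \<open>U\<close> both sides vanish.\<close>

lemma psi0_in_H:
  assumes "i < rk" shows "psi0 i \<in> H"
proof -
  have "psi0 i u = (\<Sum>w\<in>U. (psi i w / lam i) * Lminus V B d w u)" for u
  proof (cases "u \<in> U")
    case True
    have "(\<Sum>w\<in>U. (psi i w / lam i) * Lminus V B d w u) = (\<Sum>w\<in>U. Lminus V B d u w * psi i w) / lam i"
      unfolding sum_divide_distrib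
      by (intro sum.cong) (simp_all add: Lminus_sym[of u])
    then show ?thesis using True eig_vec[OF assms True] eig_pos[OF assms] by (simp add: psi0_def)
  next
    case False
    then show ?thesis by (simp add: psi0_def Lminus_def B_outside)
  qed
  then have "psi0 i = (\<lambda>u. \<Sum>w\<in>U. (psi i w / lam i) * Lminus V B d w u)" by auto
  then show ?thesis using sum_scale_in_H[where I = U and f = "Lminus V B d" and c = "\<lambda>w. psi i w / lam i"] Lminus_in_H
    by simp
qed

lemma H_expansion:
  assumes "h \<in> H" shows "h u = (\<Sum>i<rk. ipU U h (psi i) * psi0 i u)"
  using orthonormal_basis_expansion[of rk U psi0 "{(\<lambda>u. B v u) | v. v \<in> V}" H h u]
    psi0_orth psi0_in_H assms fin_V by (simp add: row_space_def mat_rank_def ipU_psi0)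

text \<open>The description operator is resolved by exhibiting the candidate. Uniqueness holds
  because an element of \<open>H\<close> is determined by its coefficients against the
  \<open>psi i\<close>, and orthogonality of the residual prescribes these.\<close>

lemma orth_proj_eq: "orth_proj U H y = (\<lambda>u. \<Sum>i<rk. ipU U y (psi i) * psi0 i u)"
  unfolding orth_proj_def
proof (rule the_equality)
  let ?x = "\<lambda>u. \<Sum>i<rk. ipU U y (psi i) * psi0 i u"
  have x: "?x \<in> H" by (rule sum_scale_in_H) (auto simp: psi0_in_H)
  have diff: "ipU U (\<lambda>u. a u - b u) c = ipU U a c - ipU U b c" for a b c :: "'u \<Rightarrow> real"
    by (simp add: ipU_def algebra_simps sum_subtractf)
  have xj: "ipU U ?x (psi j) = ipU U y (psi j)" if "j < rk" for j
  proof -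
    have "ipU U ?x (psi0 j) = (\<Sum>i<rk. if i = j then ipU U y (psi i) else 0)"
      unfolding ipU_sum_left using psi0_orth that by (intro sum.cong) auto
    then show ?thesis using that by (simp add: ipU_psi0)
  qed
  have "ipU U (\<lambda>u. y u - ?x u) h = 0" if "h \<in> H" for h
  proof -
    have "ipU U (\<lambda>u. y u - ?x u) h = ipU U (\<lambda>u. \<Sum>i<rk. ipU U h (psi i) * psi0 i u) (\<lambda>u. y u - ?x u)"
      using H_expansion[OF that] by (simp add: ipU_commute flip: H_expansion[OF that])
    also have "\<dots> = 0"
      unfolding ipU_sum_left
      by (intro sum.neutral) (auto simp: ipU_commute[of _ "psi0 _"] ipU_psi0 diff xj)
    finally show ?thesis .
  qed
  then show "?x \<in> H \<and> (\<forall>h\<in>H. ipU U (\<lambda>u. y u - ?x u) h = 0)" using x by blast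
  fix x assume x': "x \<in> H \<and> (\<forall>h\<in>H. ipU U (\<lambda>u. y u - x u) h = 0)"
  then have "ipU U x (psi j) = ipU U y (psi j)" if "j < rk" for j
    using psi0_in_H[OF that] by (auto simp: diff ipU_psi0)
  with x' show "x = ?x" using H_expansion[of x] by (auto simp: fun_eq_iff)
qed

lemma proj_mat_eq:
  assumes "u \<in> U" "w \<in> U"
  shows "K u w = (\<Sum>i<rk. psi i u * psi i w)"
proof -
  have "ipU U (\<lambda>z. if z = w then 1 else 0) (psi i) = psi i w" for i
    using assms fin_U by (simp add: ipU_def if_distrib[of "\<lambda>x. x * _"] cong: if_cong)
  then show ?thesis using assms by (simp add: proj_mat_def orth_proj_eq psi0_def mult.commute)
qed

lemma proj_kernel_K: "proj_kernel U K"
  unfolding proj_kernel_def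
proof (intro ballI conjI)
  fix u w assume uw: "u \<in> U" "w \<in> U"
  then show "K u w = K w u" by (simp add: proj_mat_eq mult.commute)
  have "(\<Sum>z\<in>U. K u z * K z w) = (\<Sum>z\<in>U. \<Sum>i<rk. \<Sum>j<rk. (psi i u * psi j w) * (psi i z * psi j z))"
    using uw by (intro sum.cong) (auto simp: proj_mat_eq sum_product intro!: sum.cong)
  also have "\<dots> = (\<Sum>i<rk. \<Sum>j<rk. \<Sum>z\<in>U. (psi i u * psi j w) * (psi i z * psi j z))"
    by (subst sum.swap, intro sum.cong refl, subst sum.swap) simp
  also have "\<dots> = (\<Sum>i<rk. \<Sum>j<rk. (psi i u * psi j w) * ipU U (psi i) (psi j))"
    by (simp add: ipU_def sum_distrib_left)
  also have "\<dots> = (\<Sum>i<rk. \<Sum>j<rk. if i = j then psi i u * psi j w else 0)"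
    using eig_orth by (intro sum.cong) auto
  finally show "(\<Sum>z\<in>U. K u z * K z w) = K u w" using uw by (simp add: proj_mat_eq)
qed

lemma trace_K: "(\<Sum>u\<in>U. K u u) = real rk"
proof -
  have "(\<Sum>u\<in>U. K u u) = (\<Sum>i<rk. ipU U (psi i) (psi i))"
    unfolding ipU_def by (subst sum.swap) (simp add: proj_mat_eq)
  then show ?thesis using eig_orth by simp
qed

text \<open>Each row of \<open>Lminus\<close> lies in \<open>H\<close>, so its expansion in the
  given eigenvectors is complete and involves positive eigenvalues only.\<close>

lemma Lminus_spectral:
  assumes "u \<in> U" "w \<in> U"
  shows "Lminus V B d u w = (\<Sum>i<rk. lam i * psi i u * psi i w)"
proof -
  have "ipU U (Lminus V B d u) (psi i) = lam i * psi i u" if "i < rk" for i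
    using eig_vec[OF that assms(1)] by (simp add: ipU_def)
  then show ?thesis using H_expansion[OF Lminus_in_H, of u w] assms by (simp add: psi0_def)
qed

section \<open>First and second moments of the eigenvalues\<close>

lemma rk_le: "rk \<le> card V"
proof -
  have "rk \<le> card {(\<lambda>u. B v u) | v. v \<in> V}"
    unfolding mat_rank_def row_space_def using fin_V by (intro fun_vs.dim_le_card) auto
  also have "{(\<lambda>u. B v u) | v. v \<in> V} = (\<lambda>v u. B v u) ` V" by auto
  also have "card \<dots> \<le> card V" using fin_V by (rule card_image_le)
  finally show ?thesis .
qed

lemma edge_count: "real (card U) * (k + 1) = real (card V) * d"
proof -
  have "(\<Sum>v\<in>V. card {u. (v, u) \<in> E}) = (\<Sum>v\<in>V. card {u\<in>U. (v, u) \<in> E})"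
    using E_sub by (intro sum.cong arg_cong[where f = card]) auto
  also have "\<dots> = (\<Sum>u\<in>U. card {v\<in>V. (v, u) \<in> E})"
    using fin_V fin_U by (intro sum_multicount_gen) auto
  also have "\<dots> = (\<Sum>u\<in>U. card {v. (v, u) \<in> E})"
    using E_sub by (intro sum.cong arg_cong[where f = card]) auto
  finally have "card V * d = card U * (k + 1)" by (simp add: deg_V deg_U)
  then have "real (card V * d) = real (card U * (k + 1))" by (rule arg_cong)
  then show ?thesis by (simp add: algebra_simps)
qed

lemma Lminus_diag: "u \<in> U \<Longrightarrow> Lminus V B d u u = (k + 1) / d"
proof -
  assume u: "u \<in> U"
  have "(\<Sum>v\<in>V. B v u * B v u) = (\<Sum>v\<in>V. if (v, u) \<in> E then 1 else 0)"
    by (simp only: B_square)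
  also have "\<dots> = real (card {v\<in>V. (v, u) \<in> E})" using fin_V by (simp flip: sum.inter_filter)
  also have "{v\<in>V. (v, u) \<in> E} = {v. (v, u) \<in> E}" using E_sub by auto
  finally show ?thesis using deg_U[OF u] by (simp add: Lminus_def)
qed

text \<open>Both sides count the walks of length two from \<open>u\<close>: \<open>k + 1\<close>
  choices for the midpoint and \<open>d\<close> for the endpoint, which may be \<open>u\<close>
  again.\<close>

lemma codegree_sum:
  assumes "u \<in> U"
  shows "(\<Sum>w\<in>U. card {v. (v, u) \<in> E \<and> (v, w) \<in> E}) = (k + 1) * d"
proof -
  let ?N = "{v. (v, u) \<in> E}"
  have N: "?N \<subseteq> V" "finite ?N" using E_sub fin_V by (auto intro: finite_subset)
  have "(\<Sum>w\<in>U. card {v. (v, u) \<in> E \<and> (v, w) \<in> E}) = (\<Sum>w\<in>U. card {v \<in> ?N. (v, w) \<in> E})"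
    by simp
  also have "\<dots> = (\<Sum>v\<in>?N. card {w\<in>U. (v, w) \<in> E})"
    using fin_U N(2) by (intro sum_multicount_gen) auto
  also have "\<dots> = (\<Sum>v\<in>?N. d)"
  proof (rule sum.cong[OF refl])
    fix v assume "v \<in> ?N"
    moreover have "{w\<in>U. (v, w) \<in> E} = {w. (v, w) \<in> E}" using E_sub by auto
    ultimately show "card {w\<in>U. (v, w) \<in> E} = d" using deg_V[of v] N by auto
  qed
  finally show ?thesis using deg_U[OF assms] by simp
qed

text \<open>The entry of \<open>B^T B\<close> is at most the codegree in absolute value. By
  \<open>C_4\<close>-freeness the codegree is 0 or 1 and equals its square, which keeps the bound
  linear and summable by \<open>codegree_sum\<close>.\<close>

lemma Lminus_offdiag_sq:
  assumes "u \<in> U" "w \<in> U" "u \<noteq> w"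
  shows "(Lminus V B d u w)\<^sup>2 \<le> real (card {v. (v, u) \<in> E \<and> (v, w) \<in> E}) / d\<^sup>2"
proof -
  let ?c = "card {v. (v, u) \<in> E \<and> (v, w) \<in> E}"
  have "\<bar>\<Sum>v\<in>V. B v u * B v w\<bar> \<le> (\<Sum>v\<in>V. \<bar>B v u * B v w\<bar>)" by (rule sum_abs)
  also have "\<dots> = (\<Sum>v\<in>V. if (v, u) \<in> E \<and> (v, w) \<in> E then 1 else 0)"
    by (intro sum.cong) (auto simp: abs_mult B_abs)
  also have "\<dots> = real (card {v\<in>V. (v, u) \<in> E \<and> (v, w) \<in> E})" using fin_V by (simp flip: sum.inter_filter)
  also have "{v\<in>V. (v, u) \<in> E \<and> (v, w) \<in> E} = {v. (v, u) \<in> E \<and> (v, w) \<in> E}" using E_sub by auto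
  finally have *: "\<bar>\<Sum>v\<in>V. B v u * B v w\<bar> \<le> real ?c" .
  have "(\<Sum>v\<in>V. B v u * B v w)\<^sup>2 \<le> (real ?c)\<^sup>2"
    using power_mono[OF * abs_ge_zero, of 2] by simp
  also have "\<dots> \<le> real ?c" using C4_U[OF assms] by (cases "?c = 0") (auto simp: le_Suc_eq)
  finally show ?thesis by (simp add: Lminus_def power_divide divide_right_mono)
qed

lemma sum_lam: "(\<Sum>i<rk. lam i) = card V"
proof -
  have "(\<Sum>u\<in>U. Lminus V B d u u) = (\<Sum>i<rk. lam i * ipU U (psi i) (psi i))"
    unfolding ipU_def sum_distrib_left by (subst sum.swap) (simp add: Lminus_spectral mult.assoc)
  also have "\<dots> = (\<Sum>i<rk. lam i)" using eig_orth by simp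
  finally have "(\<Sum>i<rk. lam i) = real (card U) * (k + 1) / d" by (simp add: Lminus_diag)
  then show ?thesis unfolding edge_count using d_pos by simp
qed

text \<open>Both sides are the diagonal entry at \<open>u\<close> of the square of
  \<open>Lminus\<close>; summing over \<open>u\<close> gives the second spectral moment.\<close>

lemma Lminus_row_norm:
  assumes "u \<in> U"
  shows "(\<Sum>w\<in>U. (Lminus V B d u w)\<^sup>2) = (\<Sum>i<rk. (lam i)\<^sup>2 * (psi i u)\<^sup>2)"
proof -
  have "(Lminus V B d u w)\<^sup>2 = (\<Sum>i<rk. lam i * psi i u * (Lminus V B d u w * psi i w))" if "w \<in> U" for w
  proof -
    have "(Lminus V B d u w)\<^sup>2 = Lminus V B d u w * (\<Sum>i<rk. lam i * psi i u * psi i w)"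
      using Lminus_spectral[OF assms that] by (simp add: power2_eq_square)
    then show ?thesis by (simp add: sum_distrib_left mult_ac)
  qed
  then have "(\<Sum>w\<in>U. (Lminus V B d u w)\<^sup>2) = (\<Sum>w\<in>U. \<Sum>i<rk. lam i * psi i u * (Lminus V B d u w * psi i w))"
    by simp
  also have "\<dots> = (\<Sum>i<rk. lam i * psi i u * (\<Sum>w\<in>U. Lminus V B d u w * psi i w))"
    by (subst sum.swap) (simp add: sum_distrib_left)
  also have "\<dots> = (\<Sum>i<rk. (lam i)\<^sup>2 * (psi i u)\<^sup>2)"
    using eig_vec assms by (intro sum.cong) (auto simp: power2_eq_square)
  finally show ?thesis .
qed

text \<open>In each row the diagonal contributes \<open>(k+1)^2 / d^2\<close> and the remaining
  entries at most \<open>(k+1)(d-1) / d^2\<close>, together \<open>(k+1)(d+k) / d^2\<close>.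
  Summation over \<open>U\<close> uses the edge count.\<close>

lemma sum_lam_sq: "(\<Sum>i<rk. (lam i)\<^sup>2) \<le> card V + card V * k / d"
proof -
  have row: "(\<Sum>w\<in>U. (Lminus V B d u w)\<^sup>2) \<le> (k + 1) * (d + k) / d\<^sup>2" if u: "u \<in> U" for u
  proof -
    let ?c = "\<lambda>w. card {v. (v, u) \<in> E \<and> (v, w) \<in> E}"
    have "(\<Sum>w\<in>U. ?c w) = ?c u + (\<Sum>w\<in>U - {u}. ?c w)" using fin_U u by (rule sum.remove)
    then have "(k + 1) * d = (k + 1) + (\<Sum>w\<in>U - {u}. ?c w)"
      using codegree_sum[OF u] deg_U[OF u] by simp
    then have "real ((k + 1) * d) = real ((k + 1) + (\<Sum>w\<in>U - {u}. ?c w))" by (rule arg_cong)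
    then have "real (k + 1) * d = real (k + 1) + (\<Sum>w\<in>U - {u}. real (?c w))"
      by (simp only: of_nat_mult of_nat_add of_nat_sum)
    moreover have "(\<Sum>w\<in>U - {u}. (Lminus V B d u w)\<^sup>2) \<le> (\<Sum>w\<in>U - {u}. real (?c w) / d\<^sup>2)"
      using u by (intro sum_mono Lminus_offdiag_sq) auto
    ultimately have "(\<Sum>w\<in>U - {u}. (Lminus V B d u w)\<^sup>2) \<le> (real (k + 1) * d - real (k + 1)) / d\<^sup>2"
      by (simp flip: sum_divide_distrib)
    moreover have "(\<Sum>w\<in>U. (Lminus V B d u w)\<^sup>2) = ((k + 1) / d)\<^sup>2 + (\<Sum>w\<in>U - {u}. (Lminus V B d u w)\<^sup>2)"
      using fin_U u by (subst sum.remove[of U u]) (auto simp: Lminus_diag)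
    moreover have "((k + 1) / d)\<^sup>2 + (real (k + 1) * d - real (k + 1)) / d\<^sup>2 = (k + 1) * (d + k) / d\<^sup>2"
      by (simp add: power_divide add_divide_distrib[symmetric] power2_eq_square algebra_simps)
    ultimately show ?thesis by linarith
  qed
  have "(\<Sum>i<rk. (lam i)\<^sup>2) = (\<Sum>i<rk. (lam i)\<^sup>2 * ipU U (psi i) (psi i))"
    using eig_orth by simp
  also have "\<dots> = (\<Sum>u\<in>U. \<Sum>w\<in>U. (Lminus V B d u w)\<^sup>2)"
    unfolding ipU_def sum_distrib_left by (subst sum.swap) (simp add: Lminus_row_norm flip: power2_eq_square)
  also have "\<dots> \<le> (\<Sum>u\<in>U. (k + 1) * (d + k) / d\<^sup>2)" by (intro sum_mono row)
  also have "\<dots> = (real (card U) * (k + 1)) * (d + k) / d\<^sup>2" by (simp add: algebra_simps)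
  also have "\<dots> = card V + card V * k / d"
    unfolding edge_count using d_pos by (simp add: field_simps power2_eq_square)
  finally show ?thesis .
qed

text \<open>The expanded square is at most \<open>n + n k / d - 2 n + rk\<close> with
  \<open>n = card V\<close>, and \<open>rk\<close> does not exceed \<open>n\<close>.\<close>

lemma sum_lam_deviation: "(\<Sum>i<rk. (lam i - 1)\<^sup>2) \<le> card V * k / d"
proof -
  have "(\<Sum>i<rk. (lam i - 1)\<^sup>2) = (\<Sum>i<rk. (lam i)\<^sup>2) - 2 * (\<Sum>i<rk. lam i) + rk"
    by (simp add: power2_diff sum.distrib sum_subtractf sum_distrib_left)
  then show ?thesis using sum_lam sum_lam_sq rk_le by linarith
qed

section \<open>Deviating eigenvalues and structured vertices\<close>

context
  fixes \<epsilon> \<delta> :: real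
  assumes \<epsilon>: "\<epsilon> > 0" "\<epsilon> \<le> 1 / 4" and \<delta>: "\<delta> > 0" "\<delta> * d \<le> 1"
begin

abbreviation "bad \<equiv> {i. i < rk \<and> (lam i - 1)\<^sup>2 > \<epsilon>}"
abbreviation "Z \<equiv> structured U rk lam psi \<epsilon> \<delta>"

lemma card_bad: "card bad \<le> card V * k / (d * \<epsilon>)"
proof -
  have "card bad * \<epsilon> = (\<Sum>i\<in>bad. \<epsilon>)" by simp
  also have "\<dots> \<le> (\<Sum>i\<in>bad. (lam i - 1)\<^sup>2)" by (intro sum_mono) auto
  also have "\<dots> \<le> (\<Sum>i<rk. (lam i - 1)\<^sup>2)" by (intro sum_mono2) auto
  also note sum_lam_deviation
  finally show ?thesis using \<epsilon> d_pos by (simp add: field_simps)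
qed

lemma sum_bad: "(\<Sum>u\<in>U. \<Sum>i\<in>bad. (psi i u)\<^sup>2) = card bad"
proof -
  have "(\<Sum>u\<in>U. \<Sum>i\<in>bad. (psi i u)\<^sup>2) = (\<Sum>i\<in>bad. ipU U (psi i) (psi i))"
    unfolding ipU_def by (subst sum.swap) (simp add: power2_eq_square)
  then show ?thesis using eig_orth by simp
qed

text \<open>Indices outside \<open>bad\<close> have \<open>lam i\<close> at least 1/2, because
  \<epsilon> is at most 1/4. Their squared entries are therefore dominated by twice the spectral sum
  for the diagonal of \<open>Lminus\<close>, which is \<open>(k + 1) / d\<close>.\<close>

lemma K_diag_le:
  assumes "u \<in> U"
  shows "K u u \<le> 2 * (k + 1) / d + (\<Sum>i\<in>bad. (psi i u)\<^sup>2)"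
proof -
  have "K u u = (\<Sum>i<rk. (psi i u)\<^sup>2)" using assms by (simp add: proj_mat_eq power2_eq_square)
  also have "\<dots> = (\<Sum>i\<in>{..<rk} - bad. (psi i u)\<^sup>2) + (\<Sum>i\<in>bad. (psi i u)\<^sup>2)"
    by (rule sum.subset_diff) auto
  also have "(\<Sum>i\<in>{..<rk} - bad. (psi i u)\<^sup>2) \<le> (\<Sum>i\<in>{..<rk} - bad. 2 * (lam i * psi i u * psi i u))"
  proof (rule sum_mono)
    fix i assume "i \<in> {..<rk} - bad"
    then have "(lam i - 1)\<^sup>2 \<le> (1 / 2)\<^sup>2" using \<epsilon> by (auto simp: power2_eq_square)
    then have "\<bar>lam i - 1\<bar> \<le> \<bar>1 / 2\<bar>" by (simp only: abs_le_square_iff)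
    then have "1 \<le> 2 * lam i" unfolding abs_le_iff by simp
    then have "1 * (psi i u)\<^sup>2 \<le> (2 * lam i) * (psi i u)\<^sup>2" by (intro mult_right_mono) auto
    then show "(psi i u)\<^sup>2 \<le> 2 * (lam i * psi i u * psi i u)" by (simp add: power2_eq_square)
  qed
  also have "\<dots> \<le> (\<Sum>i<rk. 2 * (lam i * psi i u * psi i u))"
    by (intro sum_mono2) (auto simp: mult.assoc zero_le_mult_iff less_imp_le[OF eig_pos])
  also have "\<dots> = 2 * Lminus V B d u u"
    using Lminus_spectral[OF assms assms] by (simp add: sum_distrib_left)
  also have "\<dots> = 2 * (k + 1) / d" by (simp add: Lminus_diag[OF assms])
  finally show ?thesis by simp
qed

lemma K_diag_unstructured:
  assumes "u \<in> U - Z"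
  shows "K u u \<le> (2 * k + 3) / d"
proof -
  have "(\<Sum>i\<in>bad. (psi i u)\<^sup>2) \<le> \<delta>" using assms by (auto simp: structured_def)
  also have "\<delta> \<le> 1 / d" using \<delta> d_pos by (simp add: field_simps)
  finally have "K u u \<le> 2 * (k + 1) / d + 1 / d" using K_diag_le[of u] assms by simp
  then show ?thesis by (simp add: add_divide_distrib)
qed

text \<open>Markov's inequality: the weights of the bad eigenvectors over \<open>U\<close> add up to
  \<open>card bad\<close>, so \<open>Z\<close> has at most \<open>card bad / \<delta>\<close>
  elements. The first summand comes from the \<open>2 (k + 1) / d\<close> part of each diagonal
  entry, the second from the bad weights themselves.\<close>

lemma sum_K_structured:
  "(\<Sum>u\<in>Z. K u u) \<le> card V * (2 * k * (k + 1) / (\<epsilon> * \<delta> * d\<^sup>2) + k / (\<epsilon> * d))"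
proof -
  have ZU: "Z \<subseteq> U" by (auto simp: structured_def)
  have "card Z * \<delta> = (\<Sum>u\<in>Z. \<delta>)" by simp
  also have "\<dots> \<le> (\<Sum>u\<in>Z. \<Sum>i\<in>bad. (psi i u)\<^sup>2)" by (intro sum_mono) (auto simp: structured_def)
  finally have cZ: "card Z * \<delta> \<le> (\<Sum>u\<in>Z. \<Sum>i\<in>bad. (psi i u)\<^sup>2)" .
  have sZ: "(\<Sum>u\<in>Z. \<Sum>i\<in>bad. (psi i u)\<^sup>2) \<le> card V * k / (d * \<epsilon>)"
    using sum_bad card_bad sum_mono2[OF fin_U ZU, of "\<lambda>u. \<Sum>i\<in>bad. (psi i u)\<^sup>2"]
    by (simp add: sum_nonneg)
  have "(\<Sum>u\<in>Z. K u u) \<le> (\<Sum>u\<in>Z. 2 * (k + 1) / d + (\<Sum>i\<in>bad. (psi i u)\<^sup>2))"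
    using ZU by (intro sum_mono K_diag_le) auto
  also have "\<dots> \<le> card Z * (2 * (k + 1) / d) + card V * k / (d * \<epsilon>)"
    using sZ by (simp add: sum.distrib)
  also have "real (card Z) \<le> card V * k / (d * \<epsilon>) / \<delta>"
    using order_trans[OF cZ sZ] \<delta> by (simp only: pos_le_divide_eq)
  also have "card V * k / (d * \<epsilon>) / \<delta> * (2 * (k + 1) / d) + card V * k / (d * \<epsilon>) =
      card V * (2 * k * (k + 1) / (\<epsilon> * \<delta> * d\<^sup>2) + k / (\<epsilon> * d))"
    using \<epsilon> \<delta> d_pos by (simp add: field_simps power2_eq_square)
  finally show ?thesis by (simp add: mult_right_mono divide_right_mono)
qed

end
end

section \<open>Balls, chains and explorations\<close>

lemma ball_verts_0 [simp]: "ball_verts adj x 0 = {x}"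
proof (intro equalityI subsetI)
  fix y assume "y \<in> ball_verts adj x 0"
  then obtain xs where xs: "xs \<noteq> []" "hd xs = x" "last xs = y" "length xs \<le> 1"
    by (auto simp: ball_verts_def)
  then show "y \<in> {x}" by (cases xs) auto
qed (auto simp: ball_verts_def intro!: exI[of _ "[x]"])

text \<open>Removes or appends the last vertex of a walk. The length bound in
  \<open>ball_verts\<close> counts vertices, hence the offset by one.\<close>

lemma ball_verts_Suc:
  "ball_verts adj x (Suc r) = ball_verts adj x r \<union> {y. \<exists>z\<in>ball_verts adj x r. adj z y}"
proof (intro equalityI subsetI)
  fix y assume "y \<in> ball_verts adj x (Suc r)"
  then obtain xs where xs: "xs \<noteq> []" "hd xs = x" "last xs = y" "length xs \<le> Suc r + 1" "successively adj xs"
    by (auto simp: ball_verts_def)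
  show "y \<in> ball_verts adj x r \<union> {y. \<exists>z\<in>ball_verts adj x r. adj z y}"
  proof (cases "butlast xs = []")
    case True
    then have "xs = [y]" using xs by (metis append_butlast_last_id append_Nil)
    then have "y = x" using xs by simp
    then show ?thesis by (auto simp: ball_verts_def intro!: exI[of _ "[x]"])
  next
    case False
    have split: "xs = butlast xs @ [y]" using xs by (metis append_butlast_last_id)
    then have "successively adj (butlast xs)" "adj (last (butlast xs)) y"
      using xs(5) False by (metis successively_append_iff list.sel(1) not_Cons_self2)+
    moreover have "hd (butlast xs) = x" using split xs(2) False by (metis hd_append)
    ultimately have "last (butlast xs) \<in> ball_verts adj x r"
      unfolding ball_verts_def using xs(4) False by (intro CollectI exI[of _ "butlast xs"]) auto
    then show ?thesis using \<open>adj (last (butlast xs)) y\<close> by auto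
  qed
next
  fix y assume "y \<in> ball_verts adj x r \<union> {y. \<exists>z\<in>ball_verts adj x r. adj z y}"
  then consider "y \<in> ball_verts adj x r" | z where "z \<in> ball_verts adj x r" "adj z y" by auto
  then show "y \<in> ball_verts adj x (Suc r)"
  proof cases
    case 1
    then obtain xs where "xs \<noteq> []" "hd xs = x" "last xs = y" "length xs \<le> r + 1" "successively adj xs"
      by (auto simp: ball_verts_def)
    then show ?thesis unfolding ball_verts_def by (intro CollectI exI[of _ xs]) auto
  next
    case 2
    then obtain xs where "xs \<noteq> []" "hd xs = x" "last xs = z" "length xs \<le> r + 1" "successively adj xs"
      by (auto simp: ball_verts_def)
    with 2 show ?thesis unfolding ball_verts_def
      by (intro CollectI exI[of _ "xs @ [y]"]) (auto simp: successively_append_iff)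
  qed
qed

lemma ball_verts_mono: "i \<le> j \<Longrightarrow> ball_verts adj x i \<subseteq> ball_verts adj x j"
  by (induction rule: dec_induct) (auto simp: ball_verts_Suc)

text \<open>The graph distance from \<open>x\<close>. It carries meaning only for vertices that lie
  in some ball around \<open>x\<close>, so membership in a ball accompanies its use for vertices
  other than the root.\<close>

definition level :: "('a \<Rightarrow> 'a \<Rightarrow> bool) \<Rightarrow> 'a \<Rightarrow> 'a \<Rightarrow> nat" where
  "level adj x y = (LEAST j. y \<in> ball_verts adj x j)"

lemma level_le: "y \<in> ball_verts adj x j \<Longrightarrow> level adj x y \<le> j"
  unfolding level_def by (rule Least_le)

lemma in_ball_level: "y \<in> ball_verts adj x j \<Longrightarrow> y \<in> ball_verts adj x (level adj x y)"
  unfolding level_def by (rule LeastI)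

lemma level_self [simp]: "level adj x x = 0"
  using level_le[of x adj x 0] by simp

lemma level_adj:
  assumes "z \<in> ball_verts adj x j" "adj z y"
  shows "level adj x y \<le> Suc (level adj x z)"
  using in_ball_level[OF assms(1)] assms(2) by (intro level_le) (auto simp: ball_verts_Suc)

text \<open>Supplies the previous vertex on a shortest path from \<open>x\<close>, the induction
  step for all arguments along geodesics.\<close>

lemma level_pred:
  assumes "y \<in> ball_verts adj x j" "y \<noteq> x"
  obtains z where "adj z y" "z \<in> ball_verts adj x j" "level adj x y = Suc (level adj x z)"
proof -
  have y: "y \<in> ball_verts adj x (level adj x y)" using assms(1) by (rule in_ball_level)
  with assms(2) obtain m where m: "level adj x y = Suc m" by (cases "level adj x y") auto
  have "y \<notin> ball_verts adj x m" using level_le[of y adj x m] m by auto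
  with y m obtain z where z: "z \<in> ball_verts adj x m" "adj z y" by (auto simp: ball_verts_Suc)
  have "level adj x z = m"
    using level_adj[OF z] level_le[OF z(1)] m by simp
  moreover have "m \<le> j" using level_le[OF assms(1)] m by simp
  ultimately show ?thesis using that z m ball_verts_mono[of m j adj x] by auto
qed

lemma ball_verts_path_within:
  assumes "y \<in> ball_verts adj x r"
  shows "\<exists>xs. xs \<noteq> [] \<and> hd xs = x \<and> last xs = y \<and> set xs \<subseteq> ball_verts adj x r \<and> successively adj xs"
  using assms
proof (induction r arbitrary: y)
  case 0
  then show ?case by (intro exI[of _ "[x]"]) auto
next
  case (Suc r)
  then consider "y \<in> ball_verts adj x r" | z where "z \<in> ball_verts adj x r" "adj z y"
    by (auto simp: ball_verts_Suc)
  then show ?case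
  proof cases
    case 1
    with Suc.IH[of y] show ?thesis by (auto simp: ball_verts_Suc)
  next
    case 2
    with Suc.IH[of z] obtain xs where "xs \<noteq> []" "hd xs = x" "last xs = z"
      "set xs \<subseteq> ball_verts adj x r" "successively adj xs" by auto
    with 2 Suc.prems show ?thesis
      by (intro exI[of _ "xs @ [y]"]) (auto simp: successively_append_iff ball_verts_Suc)
  qed
qed

lemma ball_verts_connected:
  assumes sym: "\<And>a b. adj a b \<Longrightarrow> adj b a"
    and "a \<in> ball_verts adj x r" "b \<in> ball_verts adj x r"
  shows "\<exists>xs. xs \<noteq> [] \<and> hd xs = a \<and> last xs = b \<and> set xs \<subseteq> ball_verts adj x r \<and> successively adj xs"
proof -
  obtain p where p: "p \<noteq> []" "hd p = x" "last p = a" "set p \<subseteq> ball_verts adj x r" "successively adj p"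
    using ball_verts_path_within[OF assms(2)] by auto
  obtain q where q: "x # q \<noteq> []" "last (x # q) = b" "set (x # q) \<subseteq> ball_verts adj x r" "successively adj (x # q)"
    \<comment> \<open>The second path is written with its root split off, so that the root is not
      repeated when it is appended to the reversed first path.\<close>
    using ball_verts_path_within[OF assms(3)] by (metis list.collapse)
  have "successively adj (rev p)"
    unfolding successively_rev by (rule successively_mono[OF p(5)]) (use sym in auto)
  then have "successively adj (rev p @ q)"
    using q p by (auto simp: successively_append_iff successively_Cons last_rev)
  moreover have "last (rev p @ q) = b"
    using p q by (auto simp: last_rev split: if_splits)
  ultimately show ?thesis
    using p q by (intro exI[of _ "rev p @ q"]) (auto simp: hd_rev)
qed

text \<open>Rotate the cycle so that it starts at a vertex maximizing \<open>f\<close>; its two neighbours on the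
  cycle are the second and the last vertex.\<close>

lemma cycle_peak:
  fixes f :: "'a \<Rightarrow> nat"
  assumes "distinct cs" "length cs \<ge> 3" "successively adj cs" "adj (last cs) (hd cs)"
    and sym: "\<And>a b. adj a b \<Longrightarrow> adj b a"
  obtains y a b where "{y, a, b} \<subseteq> set cs" "a \<noteq> b" "adj y a" "adj y b" "f a \<le> f y" "f b \<le> f y"
proof -
  have "Max (f ` set cs) \<in> f ` set cs" using assms(2) by (intro Max_in) auto
  then obtain y where y: "y \<in> set cs" "f y = Max (f ` set cs)" by (metis imageE)
  have max: "f z \<le> f y" if "z \<in> set cs" for z using that y by simp
  obtain ps qs where split: "cs = ps @ y # qs" using y(1) by (meson split_list)
  let ?R = "qs @ ps"
  have R: "length ?R \<ge> 2" "distinct ?R" "set ?R \<subseteq> set cs" using assms split by auto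
  have cyc: "adj y (hd ?R)" "adj (last ?R) y"
    using assms(2,3,4) split
    by (cases "qs = []"; cases "ps = []"; auto simp: successively_append_iff successively_Cons)+
  have "hd ?R \<noteq> last ?R"
  proof
    assume eq: "hd ?R = last ?R"
    obtain a b T where "?R = a # b # T"
      using R(1) by (metis Suc_le_length_iff numeral_2_eq_2)
    then show False using eq R(2) last_in_set[of "b # T"] by auto
  qed
  moreover have "hd ?R \<in> set cs" "last ?R \<in> set cs"
    using R by (metis hd_in_set last_in_set list.size(3) not_numeral_le_zero subset_iff)+
  ultimately show ?thesis using that[of y "hd ?R" "last ?R"] y(1) cyc max sym by auto
qed

lemma ind_adj_sym: "ind_adj E T a b \<Longrightarrow> ind_adj E T b a"
  by (cases a; cases b) auto

lemma ind_adj_Inl_iff: "ind_adj E T a (Inl v) \<longleftrightarrow> (\<exists>u. a = Inr u \<and> (v, u) \<in> E \<and> u \<in> T)"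
  by (cases a) auto

lemma ind_adj_Inr_iff: "ind_adj E T a (Inr u) \<longleftrightarrow> (\<exists>v. a = Inl v \<and> (v, u) \<in> E \<and> u \<in> T)"
  by (cases a) auto

text \<open>Every edge joins the two sides of the bipartite graph, so the side alternates along a
  shortest path. Adjacent vertices hence never have equal level.\<close>

lemma level_parity:
  assumes "y \<in> ball_verts (ind_adj E T) (Inl x) r"
  shows "even (level (ind_adj E T) (Inl x) y) \<longleftrightarrow> isl y"
  using assms
proof (induction "level (ind_adj E T) (Inl x) y" arbitrary: y)
  case 0
  then have "y = Inl x" using in_ball_level[of y] by (metis ball_verts_0 singletonD)
  then show ?case by simp
next
  case (Suc n)
  then have "y \<noteq> Inl x" by auto
  with Suc.prems obtain z where z: "ind_adj E T z y" "z \<in> ball_verts (ind_adj E T) (Inl x) r"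
    "level (ind_adj E T) (Inl x) y = Suc (level (ind_adj E T) (Inl x) z)"
    by (rule level_pred)
  then have "even (level (ind_adj E T) (Inl x) z) \<longleftrightarrow> isl z" using Suc by auto
  moreover have "isl z \<longleftrightarrow> \<not> isl y" using z(1) by (cases z; cases y) auto
  ultimately show ?case using z(3) by simp
qed

text \<open>Sequences of right vertices are stored with the most recent vertex at the head.\<close>

definition cover :: "('v \<times> 'u) set \<Rightarrow> 'v \<Rightarrow> 'u list \<Rightarrow> 'v set" where
  "cover E x us = insert x {v. \<exists>u\<in>set us. (v, u) \<in> E}"

fun exploration :: "('v \<times> 'u) set \<Rightarrow> 'v \<Rightarrow> 'u list \<Rightarrow> bool" where
  "exploration E x [] = True"
| "exploration E x (u # us) = (exploration E x us \<and> u \<notin> set us \<and> (\<exists>v\<in>cover E x us. (v, u) \<in> E))"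

text \<open>Consecutive entries determine one another up to \<open>(k + 1) d\<close> choices in
  either direction. This allows chains to be counted from their end as well as from the root, unlike
  general explorations.\<close>

fun chain :: "('v \<times> 'u) set \<Rightarrow> 'v \<Rightarrow> 'u list \<Rightarrow> bool" where
  "chain E x [] = True"
| "chain E x [u] = ((x, u) \<in> E)"
| "chain E x (u # w # us) = (u \<notin> set (w # us) \<and> (\<exists>v. (v, u) \<in> E \<and> (v, w) \<in> E) \<and> chain E x (w # us))"

text \<open>The two covered vertices are distinct, so \<open>C_4\<close>-freeness leaves at most one
  such \<open>u\<close> for each pair of them.\<close>

definition closes :: "('v \<times> 'u) set \<Rightarrow> 'v \<Rightarrow> 'u list \<Rightarrow> 'u \<Rightarrow> bool" where
  "closes E x us u \<longleftrightarrow> (\<exists>v\<in>cover E x us. \<exists>v'\<in>cover E x us. v \<noteq> v' \<and> (v, u) \<in> E \<and> (v', u) \<in> E)"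

lemma chain_exploration: "chain E x us \<Longrightarrow> exploration E x us"
  by (induction E x us rule: chain.induct) (auto simp: cover_def)

lemma exploration_distinct: "exploration E x us \<Longrightarrow> distinct us"
  by (induction us) auto

text \<open>Replay \<open>ws\<close> after \<open>us\<close>, skipping what is already present. The
  covered set is at least as large as in the original run, so every attachment remains
  valid.\<close>

lemma exploration_merge:
  assumes "exploration E x us" "exploration E x ws"
  shows "exploration E x (filter (\<lambda>w. w \<notin> set us) ws @ us)"
  using assms(2)
proof (induction ws)
  case (Cons w ws)
  moreover have "cover E x ws \<subseteq> cover E x (filter (\<lambda>w. w \<notin> set us) ws @ us)"
    by (auto simp: cover_def)
  ultimately show ?case by auto
qed (simp add: assms)

text \<open>Follow predecessors back to the root and record the right vertices. The strict drop in
  level keeps the list free of repetitions, and the final clause says how \<open>y\<close> is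
  attached to it, which is what the induction extends.\<close>

lemma geodesic:
  assumes "y \<in> ball_verts (ind_adj E T) (Inl x) r"
  shows "\<exists>us. chain E x us \<and> set us \<subseteq> T \<and> length us \<le> level (ind_adj E T) (Inl x) y \<and>
    (\<forall>u\<in>set us. Inr u \<in> ball_verts (ind_adj E T) (Inl x) r \<and>
       (Inr u = y \<or> level (ind_adj E T) (Inl x) (Inr u) < level (ind_adj E T) (Inl x) y)) \<and>
    (case y of Inl v \<Rightarrow> if us = [] then v = x else (v, hd us) \<in> E | Inr u \<Rightarrow> us \<noteq> [] \<and> hd us = u)"
  using assms
proof (induction "level (ind_adj E T) (Inl x) y" arbitrary: y)
  case 0
  then have "y = Inl x" using in_ball_level[of y] by (metis ball_verts_0 singletonD)
  then show ?case by (intro exI[of _ "[]"]) simp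
next
  case (Suc n)
  let ?L = "level (ind_adj E T) (Inl x)" and ?ball = "ball_verts (ind_adj E T) (Inl x) r"
  from Suc have "y \<noteq> Inl x" by auto
  with Suc.prems obtain z where z: "ind_adj E T z y" "z \<in> ?ball" "?L y = Suc (?L z)"
    by (rule level_pred)
  then have "n = ?L z" using Suc.hyps(2) by simp
  with Suc.hyps(1)[OF this z(2)] obtain us where us: "chain E x us" "set us \<subseteq> T" "length us \<le> ?L z"
    "\<forall>u\<in>set us. Inr u \<in> ?ball \<and> (Inr u = z \<or> ?L (Inr u) < ?L z)"
    "case z of Inl v \<Rightarrow> if us = [] then v = x else (v, hd us) \<in> E | Inr u \<Rightarrow> us \<noteq> [] \<and> hd us = u"
    by (elim exE conjE) blast
  show ?case
  proof (cases y)
    case (Inl v)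
    then obtain u where "z = Inr u" "(v, u) \<in> E" using z(1) by (auto simp: ind_adj_Inl_iff)
    with us z Inl show ?thesis by (intro exI[of _ us]) auto
  next
    case (Inr u)
    then obtain v where v: "z = Inl v" "(v, u) \<in> E" "u \<in> T" using z(1) by (auto simp: ind_adj_Inr_iff)
    \<comment> \<open>The predecessor is a left vertex, so all recorded right vertices lie strictly
      below it in level, and thus below \<open>u\<close>.\<close>
    have "u \<notin> set us" using us(4) v(1) z(3) Inr by auto
    then have "chain E x (u # us)" using us v by (cases us) auto
    with us z v Inr Suc.prems show ?thesis by (intro exI[of _ "u # us"]) auto
  qed
qed

lemma geodesic_Inl:
  assumes "Inl v \<in> ball_verts (ind_adj E T) (Inl x) r"
  obtains us where "chain E x us" "set us \<subseteq> T" "length us \<le> level (ind_adj E T) (Inl x) (Inl v)"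
    "\<And>u. u \<in> set us \<Longrightarrow> Inr u \<in> ball_verts (ind_adj E T) (Inl x) r"
    "\<And>u. u \<in> set us \<Longrightarrow> level (ind_adj E T) (Inl x) (Inr u) < level (ind_adj E T) (Inl x) (Inl v)"
    "v \<in> cover E x us"
proof -
  obtain us where "chain E x us" "set us \<subseteq> T" "length us \<le> level (ind_adj E T) (Inl x) (Inl v)"
    "\<forall>u\<in>set us. Inr u \<in> ball_verts (ind_adj E T) (Inl x) r \<and>
       level (ind_adj E T) (Inl x) (Inr u) < level (ind_adj E T) (Inl x) (Inl v)"
    "if us = [] then v = x else (v, hd us) \<in> E"
    using geodesic[OF assms] by auto
  then show ?thesis by (intro that[of us]) (auto simp: cover_def split: if_splits)
qed

lemma geodesic_Inr:
  assumes "Inr u \<in> ball_verts (ind_adj E T) (Inl x) r"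
  obtains us where "chain E x (u # us)" "set (u # us) \<subseteq> T"
    "length (u # us) \<le> level (ind_adj E T) (Inl x) (Inr u)"
    "\<And>w. w \<in> set us \<Longrightarrow> Inr w \<in> ball_verts (ind_adj E T) (Inl x) r"
    "\<And>w. w \<in> set us \<Longrightarrow> level (ind_adj E T) (Inl x) (Inr w) < level (ind_adj E T) (Inl x) (Inr u)"
proof -
  obtain us where us: "chain E x us" "set us \<subseteq> T" "length us \<le> level (ind_adj E T) (Inl x) (Inr u)"
    "\<forall>w\<in>set us. Inr w \<in> ball_verts (ind_adj E T) (Inl x) r \<and>
       (w = u \<or> level (ind_adj E T) (Inl x) (Inr w) < level (ind_adj E T) (Inl x) (Inr u))"
    "us \<noteq> []" "hd us = u"
    using geodesic[OF assms] by auto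
  then obtain us' where "us = u # us'" by (cases us) auto
  moreover from this have "u \<notin> set us'" using us(1) by (cases us') auto
  ultimately show ?thesis using us by (intro that[of us']) auto
qed

lemma cover_level:
  assumes "v \<in> cover E x us" "set us \<subseteq> T"
    and "\<And>u. u \<in> set us \<Longrightarrow> Inr u \<in> ball_verts (ind_adj E T) (Inl x) r"
    and "\<And>u. u \<in> set us \<Longrightarrow> level (ind_adj E T) (Inl x) (Inr u) < n"
  shows "level (ind_adj E T) (Inl x) (Inl v) \<le> n"
  using assms(1) unfolding cover_def
proof
  assume "v \<in> {v. \<exists>u\<in>set us. (v, u) \<in> E}"
  then obtain u where "u \<in> set us" "(v, u) \<in> E" by auto
  with assms level_adj[of "Inr u" "ind_adj E T" "Inl x" r "Inl v"] show ?thesis by fastforce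
qed simp

text \<open>Take a vertex \<open>y\<close> of highest level on a cycle; both its cycle neighbours
  lie exactly one level lower. Merging geodesics towards them gives the exploration. If
  \<open>y\<close> is a right vertex, it closes the merged list itself. If \<open>y\<close> is a
  left vertex, one of the two right neighbours closes, being joined both to \<open>y\<close> and to
  its own parent.\<close>

lemma not_tree_closing_exploration:
  assumes "\<not> is_tree (ball_verts (ind_adj E T) (Inl x) r) (ind_adj E T)"
  obtains u us where "exploration E x (u # us)" "set (u # us) \<subseteq> T" "length us \<le> 2 * r"
    "\<And>w. w \<in> set (u # us) \<Longrightarrow> Inr w \<in> ball_verts (ind_adj E T) (Inl x) r"
    "closes E x us u"
proof -
  let ?adj = "ind_adj E T"
  let ?L = "level ?adj (Inl x)" and ?ball = "ball_verts ?adj (Inl x) r"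
  \<comment> \<open>The ball is connected, so only the absence of cycles can fail.\<close>
  obtain cs where cs: "distinct cs" "length cs \<ge> 3" "set cs \<subseteq> ?ball" "successively ?adj cs"
    "?adj (last cs) (hd cs)"
    using assms ball_verts_connected[of ?adj, OF ind_adj_sym] unfolding is_tree_def by metis
  obtain y a b where yab: "{y, a, b} \<subseteq> set cs" "a \<noteq> b" "?adj y a" "?adj y b" "?L a \<le> ?L y" "?L b \<le> ?L y"
    using cycle_peak[of cs ?adj ?L] cs ind_adj_sym[of E T] by metis
  have in_ball: "y \<in> ?ball" "a \<in> ?ball" "b \<in> ?ball" using yab cs by auto
  \<comment> \<open>Adjacency allows the levels to differ by at most one, and parity rules out
    equality.\<close>
  have lev: "?L y = Suc (?L c)" if "?adj y c" "c \<in> ?ball" "?L c \<le> ?L y" for c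
  proof -
    have "even (?L y) \<noteq> even (?L c)"
      using level_parity[OF in_ball(1)] level_parity[OF that(2)] that(1) by (cases y; cases c) auto
    moreover have "?L y \<le> Suc (?L c)" using level_adj[OF that(2)] ind_adj_sym[OF that(1)] .
    ultimately show ?thesis using that(3) by (cases "?L y = ?L c") auto
  qed
  have La: "?L y = Suc (?L a)" and Lb: "?L y = Suc (?L b)" using lev yab in_ball by auto
  have Ly: "?L y \<le> r" using level_le[OF in_ball(1)] .
  show ?thesis
  proof (cases y)
    case (Inr u)
    then obtain va vb where v: "a = Inl va" "b = Inl vb" "(va, u) \<in> E" "(vb, u) \<in> E" "u \<in> T"
      using yab(3,4) by (cases a; cases b) auto
    obtain as where as: "chain E x as" "set as \<subseteq> T" "length as \<le> ?L a"
      "\<And>u. u \<in> set as \<Longrightarrow> Inr u \<in> ?ball" "\<And>u. u \<in> set as \<Longrightarrow> ?L (Inr u) < ?L a" "va \<in> cover E x as"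
      using geodesic_Inl[of va E T x r] in_ball(2) v(1) by metis
    obtain bs where bs: "chain E x bs" "set bs \<subseteq> T" "length bs \<le> ?L b"
      "\<And>u. u \<in> set bs \<Longrightarrow> Inr u \<in> ?ball" "\<And>u. u \<in> set bs \<Longrightarrow> ?L (Inr u) < ?L b" "vb \<in> cover E x bs"
      using geodesic_Inl[of vb E T x r] in_ball(3) v(2) by metis
    let ?us = "filter (\<lambda>w. w \<notin> set as) bs @ as"
    have "exploration E x ?us" using as(1) bs(1) by (intro exploration_merge chain_exploration)
    moreover have "u \<notin> set ?us" using as(5) bs(5) La Lb Inr by fastforce
    moreover have cov: "va \<in> cover E x ?us" "vb \<in> cover E x ?us"
      using as(6) bs(6) by (auto simp: cover_def)
    ultimately have "exploration E x (u # ?us)" using v by auto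
    moreover have "closes E x ?us u" using cov v yab(2) by (auto simp: closes_def)
    moreover have "length ?us \<le> 2 * r"
      unfolding length_append
      using as(3) bs(3) La Lb Ly length_filter_le[of "\<lambda>w. w \<notin> set as" bs] by linarith
    moreover have "set (u # ?us) \<subseteq> T" using as bs v by auto
    moreover have "\<And>w. w \<in> set (u # ?us) \<Longrightarrow> Inr w \<in> ?ball" using as(4) bs(4) in_ball(1) Inr by auto
    ultimately show ?thesis using that by blast
  next
    case (Inl v)
    then obtain ua ub where u: "a = Inr ua" "b = Inr ub" "(v, ua) \<in> E" "(v, ub) \<in> E" "ua \<in> T" "ub \<in> T"
      using yab(3,4) by (cases a; cases b) auto
    obtain as where as: "chain E x (ua # as)" "set (ua # as) \<subseteq> T" "length (ua # as) \<le> ?L a"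
      "\<And>u. u \<in> set as \<Longrightarrow> Inr u \<in> ?ball" "\<And>u. u \<in> set as \<Longrightarrow> ?L (Inr u) < ?L a"
      using geodesic_Inr[of ua E T x r] in_ball(2) u(1) by metis
    obtain bs where bs: "chain E x (ub # bs)" "set (ub # bs) \<subseteq> T" "length (ub # bs) \<le> ?L b"
      "\<And>u. u \<in> set bs \<Longrightarrow> Inr u \<in> ?ball" "\<And>u. u \<in> set bs \<Longrightarrow> ?L (Inr u) < ?L b"
      using geodesic_Inr[of ub E T x r] in_ball(3) u(2) by metis
    have eb: "exploration E x (ub # bs)" using bs(1) by (rule chain_exploration)
    \<comment> \<open>This is the parent of \<open>ub\<close>. Its level is at most that of
      \<open>ub\<close>, so it differs from \<open>v\<close>, which lies one level above
      \<open>ub\<close>.\<close>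
    then obtain v' where v': "v' \<in> cover E x bs" "(v', ub) \<in> E" by auto
    have "?L (Inl v') \<le> ?L b" using v'(1) bs by (intro cover_level[of _ E x bs T r]) auto
    then have "v' \<noteq> v" using Lb Inl by auto
    \<comment> \<open>Here \<open>ub\<close> is held back and added last: \<open>ua\<close> covers
      \<open>v\<close> and \<open>bs\<close> covers the parent of \<open>ub\<close>.\<close>
    let ?us = "filter (\<lambda>w. w \<notin> set (ua # as)) bs @ (ua # as)"
    have "exploration E x ?us"
      using chain_exploration[OF as(1)] eb by (intro exploration_merge) auto
    moreover have "ub \<notin> set ?us"
      using as(5) bs(5) La Lb u yab(2) by fastforce
    moreover have cov: "v \<in> cover E x ?us" "v' \<in> cover E x ?us"
      using v'(1) u(3) by (auto simp: cover_def)
    ultimately have "exploration E x (ub # ?us)" using u by auto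
    moreover have "closes E x ?us ub" using cov v' u \<open>v' \<noteq> v\<close> by (auto simp: closes_def)
    moreover have "length ?us \<le> 2 * r"
      unfolding length_append
      using as(3) bs(3) La Lb Ly length_filter_le[of "\<lambda>w. w \<notin> set (ua # as)" bs] length_Cons[of ub bs]
      by linarith
    moreover have "set (ub # ?us) \<subseteq> T" using as bs by auto
    moreover have "\<And>w. w \<in> set (ub # ?us) \<Longrightarrow> Inr w \<in> ?ball"
      using as(4) bs(4) in_ball(2,3) u(1,2) by auto
    ultimately show ?thesis using that by blast
  qed
qed

text \<open>Choose the vertex of \<open>Z\<close> in the ball of minimal level; its geodesic then
  meets \<open>Z\<close> only at the end. The strict inequality \<open>length us < r\<close> comes
  from leaving out \<open>u\<close>.\<close>

lemma hit_chain:
  assumes "ball_verts (ind_adj E T) (Inl x) r \<inter> Inr ` Z \<noteq> {}"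
  obtains u us where "chain E x (u # us)" "set (u # us) \<subseteq> T" "u \<in> Z" "set us \<inter> Z = {}" "length us < r"
proof -
  let ?L = "level (ind_adj E T) (Inl x)" and ?ball = "ball_verts (ind_adj E T) (Inl x) r"
  obtain u where u: "u \<in> Z" "Inr u \<in> ?ball"
    and min: "\<And>w. w \<in> Z \<Longrightarrow> Inr w \<in> ?ball \<Longrightarrow> ?L (Inr u) \<le> ?L (Inr w)"
    using assms ex_has_least_nat[of "\<lambda>u. u \<in> Z \<and> Inr u \<in> ?ball" _ "\<lambda>u. ?L (Inr u)"] by blast
  obtain us where us: "chain E x (u # us)" "set (u # us) \<subseteq> T" "length (u # us) \<le> ?L (Inr u)"
    "\<And>w. w \<in> set us \<Longrightarrow> Inr w \<in> ?ball" "\<And>w. w \<in> set us \<Longrightarrow> ?L (Inr w) < ?L (Inr u)"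
    using geodesic_Inr[OF u(2)] by metis
  moreover have "set us \<inter> Z = {}" using us(4,5) min by fastforce
  moreover have "length us < r" using us(3) level_le[OF u(2)] by simp
  ultimately show ?thesis using that u(1) by blast
qed

section \<open>First moment bounds\<close>

lemma card_Cons_le:
  assumes "finite A" "\<And>us. us \<in> A \<Longrightarrow> finite (F us)" "\<And>us. us \<in> A \<Longrightarrow> card (F us) \<le> c"
  shows "finite {u # us |u us. us \<in> A \<and> u \<in> F us}"
    and "card {u # us |u us. us \<in> A \<and> u \<in> F us} \<le> card A * c"
proof -
  have eq: "{u # us |u us. us \<in> A \<and> u \<in> F us} = (\<lambda>(us, u). u # us) ` Sigma A F" by force
  have fin: "finite (Sigma A F)" using assms by auto
  then show "finite {u # us |u us. us \<in> A \<and> u \<in> F us}" unfolding eq by simp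
  have "card {u # us |u us. us \<in> A \<and> u \<in> F us} \<le> card (Sigma A F)"
    unfolding eq using fin by (rule card_image_le)
  also have "\<dots> = (\<Sum>us\<in>A. card (F us))" using assms by (intro card_SigmaI) auto
  also have "\<dots> \<le> (\<Sum>us\<in>A. c)" using assms by (intro sum_mono) auto
  finally show "card {u # us |u us. us \<in> A \<and> u \<in> F us} \<le> card A * c" by simp
qed

lemma sum_power_length_le:
  fixes p :: real
  assumes "finite A" "\<And>us. us \<in> A \<Longrightarrow> length us \<le> L" "p \<ge> 0"
    and "\<And>l. l \<le> L \<Longrightarrow> real (card {us \<in> A. length us = l}) \<le> C l"
  shows "(\<Sum>us\<in>A. p ^ length us) \<le> (\<Sum>l\<le>L. C l * p ^ l)"
proof -
  have "(\<Sum>us\<in>A. p ^ length us) = (\<Sum>l\<le>L. \<Sum>us | us \<in> A \<and> length us = l. p ^ length us)"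
    using assms by (intro sum.group[symmetric]) auto
  also have "\<dots> = (\<Sum>l\<le>L. real (card {us \<in> A. length us = l}) * p ^ l)"
    by (intro sum.cong) auto
  also have "\<dots> \<le> (\<Sum>l\<le>L. C l * p ^ l)"
    using assms by (intro sum_mono mult_right_mono) auto
  finally show ?thesis .
qed

context signed_biregular
begin

lemma finite_nbrs: "finite {v. (v, u) \<in> E}" "finite {u. (v, u) \<in> E}"
  using E_sub fin_U fin_V by (auto intro: finite_subset[of _ V] finite_subset[of _ U])

lemma card_touching_le:
  assumes "W \<subseteq> V"
  shows "finite {u. \<exists>v\<in>W. (v, u) \<in> E}" "card {u. \<exists>v\<in>W. (v, u) \<in> E} \<le> card W * d"
proof -
  have fW: "finite W" using assms fin_V by (rule finite_subset)
  have eq: "{u. \<exists>v\<in>W. (v, u) \<in> E} = (\<Union>v\<in>W. {u. (v, u) \<in> E})" by auto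
  show "finite {u. \<exists>v\<in>W. (v, u) \<in> E}" unfolding eq using fW finite_nbrs by auto
  have "card {u. \<exists>v\<in>W. (v, u) \<in> E} \<le> (\<Sum>v\<in>W. card {u. (v, u) \<in> E})"
    unfolding eq using fW by (rule card_UN_le)
  also have "\<dots> = (\<Sum>v\<in>W. d)" using assms deg_V by (intro sum.cong) auto
  finally show "card {u. \<exists>v\<in>W. (v, u) \<in> E} \<le> card W * d" by simp
qed

lemma exploration_subset: "exploration E x us \<Longrightarrow> set us \<subseteq> U"
  using E_sub by (induction us) auto

lemma cover_subset: "x \<in> V \<Longrightarrow> cover E x us \<subseteq> V"
  using E_sub by (auto simp: cover_def)

lemma card_cover_le:
  assumes "set us \<subseteq> U" "length us \<le> L"
  shows "card (cover E x us) \<le> 1 + (k + 1) * L"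
proof -
  have "cover E x us = insert x (\<Union>u\<in>set us. {v. (v, u) \<in> E})" by (auto simp: cover_def)
  then have "card (cover E x us) \<le> 1 + card (\<Union>u\<in>set us. {v. (v, u) \<in> E})"
    by (simp add: card_insert_if finite_nbrs)
  also have "card (\<Union>u\<in>set us. {v. (v, u) \<in> E}) \<le> (\<Sum>u\<in>set us. card {v. (v, u) \<in> E})"
    by (rule card_UN_le) simp
  also have "\<dots> = (\<Sum>u\<in>set us. k + 1)" using assms deg_U by (intro sum.cong) auto
  also have "\<dots> \<le> L * (k + 1)"
    using card_length[of us] assms(2) by (simp only: sum_constant) (intro mult_right_mono, auto)
  finally show ?thesis by (simp add: mult.commute)
qed

text \<open>Each new vertex is a neighbour of one of at most \<open>1 + (k + 1) * L\<close> covered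
  vertices, each of degree \<open>d\<close>. The fixed bound \<open>L\<close> gives the same base
  for every length up to \<open>L\<close>.\<close>

lemma card_explorations_le:
  assumes "x \<in> V" "l \<le> L"
  shows "finite {us. exploration E x us \<and> length us = l}"
    and "card {us. exploration E x us \<and> length us = l} \<le> ((1 + (k + 1) * L) * d) ^ l"
proof -
  let ?A = "\<lambda>l. {us. exploration E x us \<and> length us = l}"
  let ?w = "1 + (k + 1) * L"
  have "finite (?A l) \<and> card (?A l) \<le> (?w * d) ^ l"
    using assms(2)
  proof (induction l)
    case 0
    have "?A 0 = {[]}" by auto
    then show ?case by simp
  next
    case (Suc l)
    let ?F = "\<lambda>us. {u. \<exists>v\<in>cover E x us. (v, u) \<in> E}"
    have IH: "finite (?A l)" "card (?A l) \<le> (?w * d) ^ l" using Suc by auto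
    have F: "finite (?F us)" "card (?F us) \<le> ?w * d" if "us \<in> ?A l" for us
    proof -
      show "finite (?F us)" using card_touching_le(1)[OF cover_subset[OF assms(1)]] .
      have "card (cover E x us) \<le> ?w"
        using that exploration_subset Suc.prems by (intro card_cover_le) auto
      then show "card (?F us) \<le> ?w * d"
        using card_touching_le(2)[OF cover_subset[OF assms(1)], of us] mult_le_mono1 le_trans by blast
    qed
    have sub: "?A (Suc l) \<subseteq> {u # us |u us. us \<in> ?A l \<and> u \<in> ?F us}"
    proof
      fix us assume "us \<in> ?A (Suc l)"
      then show "us \<in> {u # us |u us. us \<in> ?A l \<and> u \<in> ?F us}" by (cases us) auto
    qed
    have fin: "finite {u # us |u us. us \<in> ?A l \<and> u \<in> ?F us}"
      using IH(1) F by (rule card_Cons_le(1))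
    have "card (?A (Suc l)) \<le> card {u # us |u us. us \<in> ?A l \<and> u \<in> ?F us}"
      using fin sub by (rule card_mono)
    also have "\<dots> \<le> card (?A l) * (?w * d)"
      using IH(1) F by (rule card_Cons_le(2))
    also have "\<dots> \<le> (?w * d) ^ l * (?w * d)" using IH(2) by (rule mult_le_mono1)
    finally show ?case using finite_subset[OF sub fin] by (simp add: mult.commute)
  qed
  then show "finite (?A l)" "card (?A l) \<le> (?w * d) ^ l" by auto
qed

text \<open>A union over ordered pairs of distinct covered vertices, each with at most one common
  neighbour by \<open>C4_V\<close>. The bound does not involve \<open>d\<close>; this is the saving
  that makes cycles rare.\<close>

lemma card_closing_le:
  assumes "x \<in> V" "set us \<subseteq> U" "length us \<le> L"
  shows "finite {u. closes E x us u}" "card {u. closes E x us u} \<le> (1 + (k + 1) * L)\<^sup>2"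
proof -
  let ?W = "cover E x us"
  let ?P = "{(v, v') \<in> ?W \<times> ?W. v \<noteq> v'}"
  have W: "?W \<subseteq> V" using assms(1) by (rule cover_subset)
  have fW: "finite ?W" using W fin_V by (rule finite_subset)
  then have fP: "finite ?P" by (auto intro: finite_subset[of _ "?W \<times> ?W"])
  have eq: "{u. closes E x us u} = (\<Union>p\<in>?P. {u. (fst p, u) \<in> E \<and> (snd p, u) \<in> E})"
    by (auto simp: closes_def; blast)
  show "finite {u. closes E x us u}" unfolding eq using fP finite_nbrs(2) by auto
  have "card {u. closes E x us u} \<le> (\<Sum>p\<in>?P. card {u. (fst p, u) \<in> E \<and> (snd p, u) \<in> E})"
    unfolding eq using fP by (rule card_UN_le)
  also have "\<dots> \<le> (\<Sum>p\<in>?P. 1)" using W by (intro sum_mono C4_V) auto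
  also have "\<dots> = card ?P" by simp
  also have "\<dots> \<le> card (?W \<times> ?W)" using fW by (intro card_mono) auto
  also have "\<dots> = (card ?W)\<^sup>2" by (simp add: card_cartesian_product power2_eq_square)
  also have "\<dots> \<le> (1 + (k + 1) * L)\<^sup>2" using card_cover_le[OF assms(2,3)] by (rule power_mono) simp
  finally show "card {u. closes E x us u} \<le> (1 + (k + 1) * L)\<^sup>2" .
qed

text \<open>Here \<open>l\<close> is the length before the closing vertex, so the lists have length
  \<open>Suc l\<close>. The closing vertex may repeat an earlier one; distinctness is imposed where
  the lists are weighted.\<close>

definition closing :: "'v \<Rightarrow> nat \<Rightarrow> 'u list set" where
  "closing x l = {u # us |u us. us \<in> {us. exploration E x us \<and> length us = l} \<and> u \<in> {u. closes E x us u}}"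

lemma card_closing_explorations_le:
  assumes "x \<in> V" "l \<le> L"
  shows "finite (closing x l)"
    and "card (closing x l) \<le> ((1 + (k + 1) * L) * d) ^ l * (1 + (k + 1) * L)\<^sup>2"
proof -
  let ?A = "{us. exploration E x us \<and> length us = l}"
  have fin: "finite {u. closes E x us u}" and card: "card {u. closes E x us u} \<le> (1 + (k + 1) * L)\<^sup>2"
    if "us \<in> ?A" for us
    using that assms exploration_subset card_closing_le[of x us L] by auto
  show "finite (closing x l)"
    unfolding closing_def using card_explorations_le(1)[OF assms] fin card by (rule card_Cons_le(1))
  have "card (closing x l) \<le> card ?A * (1 + (k + 1) * L)\<^sup>2"
    unfolding closing_def using card_explorations_le(1)[OF assms] fin card by (rule card_Cons_le(2))
  also have "\<dots> \<le> ((1 + (k + 1) * L) * d) ^ l * (1 + (k + 1) * L)\<^sup>2"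
    using card_explorations_le(2)[OF assms] by (rule mult_le_mono1)
  finally show "card (closing x l) \<le> \<dots>" .
qed

text \<open>The end \<open>u\<close> is fixed and the root \<open>x\<close> is free, which suits a
  sum over all roots; \<open>l\<close> counts the vertices before \<open>u\<close>.\<close>

definition chains_ending :: "'u \<Rightarrow> nat \<Rightarrow> ('v \<times> 'u list) set" where
  "chains_ending u l = {(x, us). chain E x (u # us) \<and> length us = l}"

text \<open>Going backwards, each earlier right vertex has \<open>(k + 1) d\<close> candidates, and
  at the start of the chain there are \<open>k + 1\<close> choices for the root.\<close>

lemma card_chains_ending_le:
  assumes "u \<in> U"
  shows "finite (chains_ending u l)" "card (chains_ending u l) \<le> (k + 1) * ((k + 1) * d) ^ l"
proof -
  have "finite (chains_ending u l) \<and> card (chains_ending u l) \<le> (k + 1) * ((k + 1) * d) ^ l"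
    using assms
  proof (induction l arbitrary: u)
    case 0
    have "chains_ending u 0 = (\<lambda>x. (x, [])) ` {v. (v, u) \<in> E}" by (auto simp: chains_ending_def)
    then show ?case using finite_nbrs(1) deg_U[OF 0] by (simp add: card_image inj_on_def)
  next
    case (Suc l)
    let ?W = "{w. \<exists>v\<in>{v. (v, u) \<in> E}. (v, w) \<in> E}"
    have NV: "{v. (v, u) \<in> E} \<subseteq> V" using E_sub by auto
    have fW: "finite ?W" using card_touching_le(1)[OF NV] .
    have cW: "card ?W \<le> (k + 1) * d" using card_touching_le(2)[OF NV] deg_U[OF Suc.prems] by simp
    have IH: "finite (chains_ending w l)" "card (chains_ending w l) \<le> (k + 1) * ((k + 1) * d) ^ l"
      if "w \<in> ?W" for w
      using that E_sub Suc.IH[of w] by auto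
    let ?f = "\<lambda>w (x, us). (x, w # us)"
    have sub: "chains_ending u (Suc l) \<subseteq> (\<Union>w\<in>?W. ?f w ` chains_ending w l)"
    proof
      fix p assume "p \<in> chains_ending u (Suc l)"
      then obtain x w us where "p = (x, w # us)" "chain E x (u # w # us)" "length us = l"
        by (auto simp: chains_ending_def length_Suc_conv)
      then show "p \<in> (\<Union>w\<in>?W. ?f w ` chains_ending w l)"
        by (auto simp: chains_ending_def image_iff)
    qed
    have fin: "finite (\<Union>w\<in>?W. ?f w ` chains_ending w l)" using fW IH(1) by blast
    have "card (chains_ending u (Suc l)) \<le> card (\<Union>w\<in>?W. ?f w ` chains_ending w l)"
      using fin sub by (rule card_mono)
    also have "\<dots> \<le> (\<Sum>w\<in>?W. card (?f w ` chains_ending w l))" using fW by (rule card_UN_le)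
    also have "\<dots> \<le> (\<Sum>w\<in>?W. (k + 1) * ((k + 1) * d) ^ l)"
      using IH by (intro sum_mono) (meson card_image_le le_trans)
    also have "\<dots> = card ?W * ((k + 1) * ((k + 1) * d) ^ l)" by simp
    also have "\<dots> \<le> (k + 1) * d * ((k + 1) * ((k + 1) * d) ^ l)" using cW by (rule mult_le_mono1)
    also have "\<dots> = (k + 1) * ((k + 1) * d) ^ Suc l" by (simp only: power_Suc mult_ac)
    finally show ?case using finite_subset[OF sub fin] by auto
  qed
  then show "finite (chains_ending u l)" "card (chains_ending u l) \<le> (k + 1) * ((k + 1) * d) ^ l" by auto
qed

end

section \<open>Expectations over the sample and the uniform root\<close>

context signed_biregular_eig
begin

definition expectation :: "('u set \<Rightarrow> 'v \<Rightarrow> real) \<Rightarrow> real" where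
  "expectation f = (1 / real (card V)) *
     (\<Sum>x\<in>V. \<Sum>S\<in>{S. S \<subseteq> U \<and> card S = rk}. det_measure U H S * f S x)"

lemma sample_prob_expectation:
  "sample_prob V U B P = expectation (\<lambda>S x. if P S x then 1 else 0)"
  by (simp add: sample_prob_def expectation_def)

lemma det_measure_nonneg: "S \<subseteq> U \<Longrightarrow> det_measure U H S \<ge> 0"
  unfolding det_measure_def using fin_U proj_kernel_K
  by (intro det_on_nonneg[of S U]) (auto intro: finite_subset)

lemma sum_det_measure: "(\<Sum>S\<in>{S. S \<subseteq> U \<and> card S = rk}. det_measure U H S) = 1"
  unfolding det_measure_def using fin_U proj_kernel_K trace_K by (rule sum_det_on_eq_1)

lemma expectation_mono:
  assumes "\<And>S x. S \<subseteq> U \<Longrightarrow> x \<in> V \<Longrightarrow> f S x \<le> g S x"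
  shows "expectation f \<le> expectation g"
  unfolding expectation_def using assms det_measure_nonneg
  by (intro mult_left_mono sum_mono) auto

lemma expectation_add: "expectation (\<lambda>S x. f S x + g S x) = expectation f + expectation g"
  by (simp add: expectation_def sum.distrib algebra_simps)

lemma expectation_cmult: "expectation (\<lambda>S x. c * f S x) = c * expectation f"
  by (simp add: expectation_def sum_distrib_left algebra_simps)

lemma expectation_const: "V \<noteq> {} \<Longrightarrow> expectation (\<lambda>S x. c) = c"
  using fin_V by (simp add: expectation_def sum_det_measure flip: sum_distrib_right)

lemma expectation_const_le:
  assumes "c \<ge> 0" shows "expectation (\<lambda>S x. c) \<le> c"
proof (cases "V = {}")
  case True
  then show ?thesis unfolding expectation_def using assms by simp
qed (simp add: expectation_const)

lemma sample_prob_nonneg: "sample_prob V U B P \<ge> 0"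
  unfolding sample_prob_def using det_measure_nonneg by (intro mult_nonneg_nonneg sum_nonneg) auto

text \<open>A union bound combined with Markov's inequality: outside the exceptional event
  \<open>Q\<close>, the event \<open>P\<close> is paid for by a nonnegative \<open>f\<close> that is
  at least 1 on it.\<close>

lemma sample_prob_le:
  assumes "\<And>S x. S \<subseteq> U \<Longrightarrow> x \<in> V \<Longrightarrow> P S x \<Longrightarrow> \<not> Q S x \<Longrightarrow> 1 \<le> f S x"
    and "\<And>S x. S \<subseteq> U \<Longrightarrow> x \<in> V \<Longrightarrow> 0 \<le> f S x"
  shows "sample_prob V U B P \<le> sample_prob V U B Q + expectation f"
  unfolding sample_prob_expectation expectation_add[symmetric]
proof (rule expectation_mono)
  fix S x assume "S \<subseteq> U" "x \<in> V"
  then show "(if P S x then 1 else 0) \<le> (if Q S x then 1 else 0) + f S x"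
    using assms(1)[of S x] assms(2)[of S x] by (cases "P S x"; cases "Q S x") simp_all
qed

lemma sample_prob_not:
  assumes "V \<noteq> {}"
  shows "sample_prob V U B (\<lambda>S x. \<not> P S x) = 1 - sample_prob V U B P"
proof -
  have "sample_prob V U B (\<lambda>S x. \<not> P S x) + sample_prob V U B P = expectation (\<lambda>S x. 1)"
    unfolding sample_prob_expectation expectation_add[symmetric]
    by (rule arg_cong[where f = expectation]) (auto simp: fun_eq_iff)
  then show ?thesis using expectation_const[OF assms, of 1] by simp
qed

text \<open>Linearity of expectation reduces the count to the probabilities that single lists are
  retained, which \<open>sum_det_on_superset_le\<close> bounds.\<close>

lemma expectation_count_le:
  assumes "\<And>x. x \<in> V \<Longrightarrow> finite (A x)" "\<And>x us. x \<in> V \<Longrightarrow> us \<in> A x \<Longrightarrow> set us \<subseteq> U"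
  shows "expectation (\<lambda>S x. real (card {us \<in> A x. set us \<subseteq> S})) \<le>
    (1 / real (card V)) * (\<Sum>x\<in>V. \<Sum>us\<in>A x. \<Prod>u\<in>set us. K u u)"
  unfolding expectation_def
proof (intro mult_left_mono sum_mono)
  fix x assume x: "x \<in> V"
  let ?\<Omega> = "{S. S \<subseteq> U \<and> card S = rk}"
  have fin: "finite ?\<Omega>" using fin_U by simp
  have "(\<Sum>S\<in>?\<Omega>. det_measure U H S * real (card {us \<in> A x. set us \<subseteq> S})) =
      (\<Sum>S\<in>?\<Omega>. \<Sum>us\<in>A x. if set us \<subseteq> S then det_measure U H S else 0)"
    using assms(1)[OF x] by (intro sum.cong) (simp_all flip: sum.inter_filter)
  also have "\<dots> = (\<Sum>us\<in>A x. \<Sum>S\<in>?\<Omega>. if set us \<subseteq> S then det_measure U H S else 0)" by (rule sum.swap)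
  also have "\<dots> = (\<Sum>us\<in>A x. \<Sum>S | S \<subseteq> U \<and> card S = rk \<and> set us \<subseteq> S. det_on S K)"
    using fin by (simp add: det_measure_def conj_assoc flip: sum.inter_filter)
  also have "\<dots> \<le> (\<Sum>us\<in>A x. \<Prod>u\<in>set us. K u u)"
    using fin_U proj_kernel_K trace_K assms(2)[OF x]
    by (intro sum_mono sum_det_on_superset_le) auto
  finally show "(\<Sum>S\<in>?\<Omega>. det_measure U H S * real (card {us \<in> A x. set us \<subseteq> S})) \<le>
    (\<Sum>us\<in>A x. \<Prod>u\<in>set us. K u u)" .
qed simp

lemma expectation_count_le_const:
  assumes "\<And>x. x \<in> V \<Longrightarrow> finite (A x)" "\<And>x us. x \<in> V \<Longrightarrow> us \<in> A x \<Longrightarrow> set us \<subseteq> U"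
    and "\<And>x. x \<in> V \<Longrightarrow> (\<Sum>us\<in>A x. \<Prod>u\<in>set us. K u u) \<le> c" "c \<ge> 0"
  shows "expectation (\<lambda>S x. real (card {us \<in> A x. set us \<subseteq> S})) \<le> c"
proof -
  have "expectation (\<lambda>S x. real (card {us \<in> A x. set us \<subseteq> S})) \<le>
      (1 / real (card V)) * (\<Sum>x\<in>V. \<Sum>us\<in>A x. \<Prod>u\<in>set us. K u u)"
    using assms(1,2) by (rule expectation_count_le)
  also have "\<dots> \<le> (1 / real (card V)) * (\<Sum>x\<in>V. c)"
    using assms(3) by (intro mult_left_mono sum_mono) auto
  also have "\<dots> \<le> c" using assms(4) by simp
  finally show ?thesis .
qed

section \<open>Estimates for a kernel that is small outside an exceptional set\<close>

context
  fixes Z :: "'u set" and c \<beta> :: real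
  assumes Z: "Z \<subseteq> U" and c: "c \<ge> 0"
    and K_le: "\<And>u. u \<in> U - Z \<Longrightarrow> K u u \<le> c / d"
    and K_Z: "(\<Sum>u\<in>Z. K u u) \<le> card V * \<beta>" and \<beta>: "\<beta> \<ge> 0"
begin

lemma K_nonneg: "u \<in> U \<Longrightarrow> K u u \<ge> 0"
  using proj_kernel_diag_nonneg[OF fin_U proj_kernel_K] .

lemma prod_K_le:
  assumes "distinct us" "set us \<subseteq> U - Z"
  shows "(\<Prod>u\<in>set us. K u u) \<le> (c / d) ^ length us"
proof -
  have "(\<Prod>u\<in>set us. K u u) \<le> (\<Prod>u\<in>set us. c / d)"
    using assms K_le K_nonneg by (intro prod_mono) auto
  then show ?thesis using assms(1) by (simp add: distinct_card)
qed

abbreviation "hits r \<equiv> \<lambda>S x. ball_verts (ind_adj E S) (Inl x) r \<inter> Inr ` Z \<noteq> {}"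

text \<open>Sum over the end \<open>u\<close> in \<open>Z\<close> first. It weighs
  \<open>K u u\<close>, the \<open>l\<close> earlier vertices weigh at most \<open>c / d\<close>
  each, and the number of such chains is of order \<open>d ^ l\<close>, so the powers of
  \<open>d\<close> cancel. The total mass on \<open>Z\<close> absorbs the normalization by
  \<open>card V\<close>.\<close>

lemma sample_prob_hits_le:
  "sample_prob V U B (hits r) \<le> \<beta> * (\<Sum>l<r. (k + 1) * ((k + 1) * c) ^ l)"
proof -
  define A where "A x = {zs. \<exists>u us. zs = u # us \<and> chain E x (u # us) \<and> u \<in> Z \<and> set us \<subseteq> U - Z \<and> length us < r}" for x
  have A: "exploration E x us" "set us \<subseteq> U" "length us \<le> r" if "us \<in> A x" for x us
    using that exploration_subset[of x us] by (auto simp: A_def dest: chain_exploration)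
  have fA: "finite (A x)" if "x \<in> V" for x
  proof (rule finite_subset)
    show "A x \<subseteq> (\<Union>l\<in>{..r}. {us. exploration E x us \<and> length us = l})" using A by auto
    show "finite (\<Union>l\<in>{..r}. {us. exploration E x us \<and> length us = l})"
      using card_explorations_le(1)[OF that order_refl] by auto
  qed
  have "sample_prob V U B (hits r) \<le> expectation (\<lambda>S x. real (card {us \<in> A x. set us \<subseteq> S}))"
    unfolding sample_prob_expectation
  proof (rule expectation_mono)
    fix S x assume S: "S \<subseteq> U" and x: "x \<in> V"
    show "(if hits r S x then 1 else 0) \<le> real (card {us \<in> A x. set us \<subseteq> S})"
    proof (cases "hits r S x")
      case True
      then obtain u us where "chain E x (u # us)" "set (u # us) \<subseteq> S" "u \<in> Z" "set us \<inter> Z = {}" "length us < r"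
        by (rule hit_chain)
      then have "u # us \<in> {us \<in> A x. set us \<subseteq> S}" using S by (auto simp: A_def)
      then have "{us \<in> A x. set us \<subseteq> S} \<noteq> {}" by blast
      then have "0 < card {us \<in> A x. set us \<subseteq> S}" using fA[OF x] by (simp add: card_gt_0_iff)
      then show ?thesis by simp
    qed simp
  qed
  also have "\<dots> \<le> (1 / real (card V)) * (\<Sum>x\<in>V. \<Sum>us\<in>A x. \<Prod>u\<in>set us. K u u)"
    using fA A(2) by (rule expectation_count_le)
  also have "(\<Sum>x\<in>V. \<Sum>us\<in>A x. \<Prod>u\<in>set us. K u u) \<le>
      (\<Sum>u\<in>Z. \<Sum>l<r. \<Sum>p\<in>chains_ending u l. K u u * (c / d) ^ l)"
  proof -
    have fZ: "finite Z" using Z fin_U by (rule finite_subset)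
    have fC: "finite (chains_ending u l)" if "u \<in> Z" for u l
      using that Z by (intro card_chains_ending_le) auto
    have "(\<Sum>x\<in>V. \<Sum>us\<in>A x. \<Prod>u\<in>set us. K u u) = (\<Sum>(x, us)\<in>Sigma V A. \<Prod>u\<in>set us. K u u)"
      using fin_V fA by (intro sum.Sigma) auto
    also have "\<dots> \<le> (\<Sum>(u, l, p)\<in>Sigma Z (\<lambda>u. Sigma {..<r} (chains_ending u)). K u u * (c / d) ^ l)"
    \<comment> \<open>A root with its list is matched to the list's end, the number of remaining
      vertices and the backward chain, so that the outer sum runs over \<open>Z\<close>.\<close>
    proof (rule sum_le_included[where i = "\<lambda>(u, l, x, us). (x, u # us)"])
      show "finite (Sigma V A)" using fin_V fA by auto
      show "finite (Sigma Z (\<lambda>u. Sigma {..<r} (chains_ending u)))" using fZ fC by auto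
      show "\<forall>y\<in>Sigma Z (\<lambda>u. Sigma {..<r} (chains_ending u)). 0 \<le> (case y of (u, l, p) \<Rightarrow> K u u * (c / d) ^ l)"
        using K_nonneg c Z by auto
      show "\<forall>y\<in>Sigma V A. \<exists>z\<in>Sigma Z (\<lambda>u. Sigma {..<r} (chains_ending u)).
          (case z of (u, l, x, us) \<Rightarrow> (x, u # us)) = y \<and>
          (case y of (x, us) \<Rightarrow> \<Prod>u\<in>set us. K u u) \<le> (case z of (u, l, p) \<Rightarrow> K u u * (c / d) ^ l)"
      proof
        fix y assume "y \<in> Sigma V A"
        then obtain x u us where y: "y = (x, u # us)" "chain E x (u # us)" "u \<in> Z" "set us \<subseteq> U - Z" "length us < r"
          by (auto simp: A_def)
        have dist: "distinct (u # us)" using y(2) by (intro exploration_distinct chain_exploration)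
        then have "(\<Prod>u\<in>set (u # us). K u u) = K u u * (\<Prod>u\<in>set us. K u u)" by simp
        also have "\<dots> \<le> K u u * (c / d) ^ length us"
          using dist y Z K_nonneg by (intro mult_left_mono prod_K_le) auto
        finally show "\<exists>z\<in>Sigma Z (\<lambda>u. Sigma {..<r} (chains_ending u)).
          (case z of (u, l, x, us) \<Rightarrow> (x, u # us)) = y \<and>
          (case y of (x, us) \<Rightarrow> \<Prod>u\<in>set us. K u u) \<le> (case z of (u, l, p) \<Rightarrow> K u u * (c / d) ^ l)"
          using y by (intro bexI[of _ "(u, length us, x, us)"]) (auto simp: chains_ending_def)
      qed
    qed
    also have "\<dots> = (\<Sum>u\<in>Z. \<Sum>(l, p)\<in>Sigma {..<r} (chains_ending u). K u u * (c / d) ^ l)"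
      using fZ fC by (intro sum.Sigma[symmetric]) auto
    also have "\<dots> = (\<Sum>u\<in>Z. \<Sum>l<r. \<Sum>p\<in>chains_ending u l. K u u * (c / d) ^ l)"
      using fC by (intro sum.cong[OF refl] sum.Sigma[symmetric]) auto
    finally show ?thesis .
  qed
  also have "\<dots> \<le> (\<Sum>u\<in>Z. K u u * (\<Sum>l<r. (k + 1) * ((k + 1) * c) ^ l))"
  proof (rule sum_mono)
    fix u assume u: "u \<in> Z"
    have "(\<Sum>l<r. \<Sum>p\<in>chains_ending u l. K u u * (c / d) ^ l) =
        K u u * (\<Sum>l<r. card (chains_ending u l) * (c / d) ^ l)"
      by (simp add: sum_distrib_left mult_ac)
    also have "\<dots> \<le> K u u * (\<Sum>l<r. (k + 1) * ((k + 1) * c) ^ l)"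
    proof (intro mult_left_mono sum_mono)
      fix l
      have "real (card (chains_ending u l)) \<le> real ((k + 1) * ((k + 1) * d) ^ l)"
        using u Z by (intro of_nat_mono card_chains_ending_le) auto
      then have "real (card (chains_ending u l)) * (c / d) ^ l \<le> real ((k + 1) * ((k + 1) * d) ^ l) * (c / d) ^ l"
        using c by (intro mult_right_mono) auto
      also have "\<dots> = (k + 1) * (real (k + 1) * d * (c / d)) ^ l"
        by (simp only: of_nat_mult of_nat_power power_mult_distrib mult_ac)
      also have "real (k + 1) * d * (c / d) = (k + 1) * c" using d_pos by simp
      finally show "real (card (chains_ending u l)) * (c / d) ^ l \<le> (k + 1) * ((k + 1) * c) ^ l" .
    qed (use u Z K_nonneg in auto)
    finally show "(\<Sum>l<r. \<Sum>p\<in>chains_ending u l. K u u * (c / d) ^ l) \<le>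
      K u u * (\<Sum>l<r. (k + 1) * ((k + 1) * c) ^ l)" .
  qed
  also have "\<dots> = (\<Sum>u\<in>Z. K u u) * (\<Sum>l<r. (k + 1) * ((k + 1) * c) ^ l)" by (rule sum_distrib_right[symmetric])
  also have "\<dots> \<le> (card V * \<beta>) * (\<Sum>l<r. (k + 1) * ((k + 1) * c) ^ l)"
    using K_Z c by (intro mult_right_mono sum_nonneg) auto
  finally have *: "sample_prob V U B (hits r) \<le>
    (1 / real (card V)) * ((card V * \<beta>) * (\<Sum>l<r. (k + 1) * ((k + 1) * c) ^ l))"
    by (simp add: mult_left_mono divide_right_mono)
  have nonneg: "\<beta> * (\<Sum>l<r. (k + 1) * ((k + 1) * c) ^ l) \<ge> 0"
    using \<beta> c by (intro mult_nonneg_nonneg sum_nonneg) auto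
  \<comment> \<open>For empty \<open>V\<close> the factor \<open>1 / card V\<close> is 0 by
    convention and the right-hand side is nonnegative; otherwise \<open>card V\<close>
    cancels.\<close>
  show ?thesis
  proof (cases "card V = 0")
    case True
    with * nonneg show ?thesis by simp
  next
    case False
    with * show ?thesis by simp
  qed
qed

text \<open>There are at most \<open>(w d) ^ l\<close> explorations of length \<open>l\<close>, with
  \<open>w = 1 + (k + 1) * L\<close>, each of weight at most \<open>(c / d) ^ l\<close>, so
  \<open>d\<close> disappears. The separate bound \<open>L\<close> lets the same \<open>w\<close>
  serve here and in the cycle estimate.\<close>

lemma explorations_outside:
  assumes "x \<in> V" "r \<le> L"
  defines "A \<equiv> {us. exploration E x us \<and> set us \<subseteq> U - Z \<and> length us \<le> r}"
  shows "finite A" "(\<Sum>us\<in>A. \<Prod>u\<in>set us. K u u) \<le> (\<Sum>l\<le>r. ((1 + (k + 1) * L) * c) ^ l)"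
proof -
  let ?w = "1 + (k + 1) * L"
  have fl: "finite {us. exploration E x us \<and> length us = l}"
    and cl: "card {us. exploration E x us \<and> length us = l} \<le> (?w * d) ^ l" if "l \<le> r" for l
    using that assms(2) card_explorations_le[OF assms(1), of l L] by auto
  show fA: "finite A"
    by (rule finite_subset[of _ "\<Union>l\<in>{..r}. {us. exploration E x us \<and> length us = l}"])
      (use fl in \<open>auto simp: A_def\<close>)
  have "(\<Sum>us\<in>A. \<Prod>u\<in>set us. K u u) \<le> (\<Sum>us\<in>A. (c / d) ^ length us)"
    by (intro sum_mono prod_K_le) (auto simp: A_def dest: exploration_distinct)
  also have "\<dots> \<le> (\<Sum>l\<le>r. real ((?w * d) ^ l) * (c / d) ^ l)"
  proof (rule sum_power_length_le)
    fix l assume "l \<le> r"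
    then have "card {us \<in> A. length us = l} \<le> card {us. exploration E x us \<and> length us = l}"
      by (intro card_mono fl) (auto simp: A_def)
    also have "\<dots> \<le> (?w * d) ^ l" using cl \<open>l \<le> r\<close> by blast
    finally show "real (card {us \<in> A. length us = l}) \<le> real ((?w * d) ^ l)" by (rule of_nat_mono)
  qed (use fA c in \<open>auto simp: A_def\<close>)
  also have "\<dots> = (\<Sum>l\<le>r. (?w * c) ^ l)"
  proof (rule sum.cong[OF refl])
    fix l
    have "real ((?w * d) ^ l) * (c / d) ^ l = (real ?w * d * (c / d)) ^ l"
      by (simp only: of_nat_mult of_nat_power power_mult_distrib)
    also have "real ?w * d * (c / d) = ?w * c" using d_pos by simp
    finally show "real ((?w * d) ^ l) * (c / d) ^ l = (?w * c) ^ l" .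
  qed
  finally show "(\<Sum>us\<in>A. \<Prod>u\<in>set us. K u u) \<le> (\<Sum>l\<le>r. (?w * c) ^ l)" .
qed

text \<open>Every right vertex of the ball is the head of a retained geodesic, so there are at most
  as many as retained explorations. Left vertices other than the root are neighbours of these, at
  most \<open>k + 1\<close> for each.\<close>

lemma card_ball_le:
  assumes "S \<subseteq> U" "x \<in> V" "\<not> hits r S x"
  defines "A \<equiv> {us. exploration E x us \<and> set us \<subseteq> U - Z \<and> length us \<le> r}"
  shows "card (ball_verts (ind_adj E S) (Inl x) r) \<le> 1 + (k + 2) * card {us \<in> A. set us \<subseteq> S}"
proof -
  let ?ball = "ball_verts (ind_adj E S) (Inl x) r"
  define Q where "Q = {u. Inr u \<in> ?ball}"
  have Q_us: "\<exists>us\<in>{us \<in> A. set us \<subseteq> S}. u = hd us" if u: "u \<in> Q" for u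
  proof -
    obtain us where us: "chain E x (u # us)" "set (u # us) \<subseteq> S"
      "length (u # us) \<le> level (ind_adj E S) (Inl x) (Inr u)"
      "\<And>w. w \<in> set us \<Longrightarrow> Inr w \<in> ?ball"
      by (rule geodesic_Inr[OF u[unfolded Q_def mem_Collect_eq]]) blast
    have "Inr w \<in> ?ball" if "w \<in> set (u # us)" for w using us(4) u that by (auto simp: Q_def)
    \<comment> \<open>The whole geodesic lies in the ball, which avoids \<open>Z\<close> by
      assumption.\<close>
    then have "set (u # us) \<subseteq> U - Z" using us(2) assms(1,3) by blast
    moreover have "length (u # us) \<le> r"
      using us(3) u level_le[of "Inr u" "ind_adj E S" "Inl x" r] by (simp add: Q_def)
    ultimately have "u # us \<in> {us \<in> A. set us \<subseteq> S}"
      using us(2) chain_exploration[OF us(1)] by (simp add: A_def)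
    then show ?thesis by (metis list.sel(1))
  qed
  have fA: "finite {us \<in> A. set us \<subseteq> S}"
    by (rule finite_subset[OF _ explorations_outside(1)[OF assms(2) order_refl, of r]]) (auto simp: A_def)
  have QS: "Q \<subseteq> hd ` {us \<in> A. set us \<subseteq> S}" using Q_us by blast
  have fQ: "finite Q" using finite_subset[OF QS] fA by blast
  have QU: "Q \<subseteq> U"
  proof
    fix u assume "u \<in> Q"
    then obtain us where "us \<in> A" "set us \<subseteq> S" "u = hd us" using Q_us by blast
    moreover have "Inr u \<in> ?ball" using \<open>u \<in> Q\<close> by (simp add: Q_def)
    then obtain z where "ind_adj E S z (Inr u)" by (rule level_pred) (simp, blast)
    ultimately show "u \<in> U" using assms(1) by (cases z) auto
  qed
  have ball: "?ball \<subseteq> insert (Inl x) (Inr ` Q \<union> Inl ` (\<Union>u\<in>Q. {v. (v, u) \<in> E}))"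
  proof
    fix y assume y: "y \<in> ?ball"
    show "y \<in> insert (Inl x) (Inr ` Q \<union> Inl ` (\<Union>u\<in>Q. {v. (v, u) \<in> E}))"
    proof (cases y)
      case (Inr u)
      then show ?thesis using y by (simp add: Q_def)
    next
      case (Inl v)
      show ?thesis
      proof (cases "y = Inl x")
        case False
        with y obtain z where "ind_adj E S z y" "z \<in> ?ball" by (rule level_pred)
        then show ?thesis using Inl by (auto simp: ind_adj_Inl_iff Q_def)
      qed simp
    qed
  qed
  have fU: "finite (\<Union>u\<in>Q. {v. (v, u) \<in> E})" using fQ finite_nbrs(1) by auto
  have "card ?ball \<le> card (insert (Inl x) (Inr ` Q \<union> Inl ` (\<Union>u\<in>Q. {v. (v, u) \<in> E})))"
    using ball fQ fU by (intro card_mono) auto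
  also have "\<dots> \<le> 1 + card (Inr ` Q \<union> Inl ` (\<Union>u\<in>Q. {v. (v, u) \<in> E}) :: ('v + 'u) set)"
    using fQ fU by (simp add: card_insert_if)
  also have "\<dots> \<le> 1 + (card (Inr ` Q :: ('v + 'u) set) + card (Inl ` (\<Union>u\<in>Q. {v. (v, u) \<in> E}) :: ('v + 'u) set))"
    by (intro add_left_mono card_Un_le)
  also have "\<dots> = 1 + (card Q + card (\<Union>u\<in>Q. {v. (v, u) \<in> E}))"
    by (simp add: card_image)
  also have "card (\<Union>u\<in>Q. {v. (v, u) \<in> E}) \<le> (\<Sum>u\<in>Q. card {v. (v, u) \<in> E})"
    using fQ by (rule card_UN_le)
  also have "\<dots> = (\<Sum>u\<in>Q. k + 1)" using QU deg_U by (intro sum.cong) auto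
  also have "1 + (card Q + (\<Sum>u\<in>Q. k + 1)) = 1 + (k + 2) * card Q" by (simp add: algebra_simps)
  also have "\<dots> \<le> 1 + (k + 2) * card {us \<in> A. set us \<subseteq> S}"
    using surj_card_le[OF fA QS] by (intro add_left_mono mult_left_mono) auto
  finally show ?thesis by simp
qed

lemma sample_prob_large_ball_le:
  fixes t :: real
  assumes t: "t > 0" and L: "r \<le> L"
  shows "sample_prob V U B (\<lambda>S x. real (card (ball_verts (ind_adj E S) (Inl x) r)) > t) \<le>
    sample_prob V U B (hits r) + (1 + (k + 2) * (\<Sum>l\<le>r. ((1 + (k + 1) * L) * c) ^ l)) / t"
proof -
  let ?A = "\<lambda>x. {us. exploration E x us \<and> set us \<subseteq> U - Z \<and> length us \<le> r}"
  let ?X = "\<lambda>S x. real (card {us \<in> ?A x. set us \<subseteq> S})"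
  let ?M = "\<Sum>l\<le>r. ((1 + (k + 1) * L) * c) ^ l"
  have "sample_prob V U B (\<lambda>S x. real (card (ball_verts (ind_adj E S) (Inl x) r)) > t) \<le>
      sample_prob V U B (hits r) + expectation (\<lambda>S x. 1 / t + (k + 2) / t * ?X S x)"
  proof (rule sample_prob_le)
    fix S x assume *: "S \<subseteq> U" "x \<in> V" "real (card (ball_verts (ind_adj E S) (Inl x) r)) > t" "\<not> hits r S x"
    have "real (card (ball_verts (ind_adj E S) (Inl x) r)) \<le> real (1 + (k + 2) * card {us \<in> ?A x. set us \<subseteq> S})"
      using card_ball_le[OF *(1,2,4)] by (rule of_nat_mono)
    with *(3) have "t \<le> 1 + (k + 2) * ?X S x" by (simp add: algebra_simps)
    then have "1 \<le> (1 + (k + 2) * ?X S x) / t" using t by (simp add: pos_le_divide_eq)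
    then show "1 \<le> 1 / t + (k + 2) / t * ?X S x" by (simp add: add_divide_distrib algebra_simps)
  qed (use t in auto)
  moreover have "expectation (\<lambda>S x. 1 / t + (k + 2) / t * ?X S x) \<le> 1 / t + (k + 2) / t * ?M"
    unfolding expectation_add expectation_cmult
  proof (intro add_mono mult_left_mono)
    show "expectation (\<lambda>S x. 1 / t) \<le> 1 / t" using t by (intro expectation_const_le) simp
    show "expectation ?X \<le> ?M"
      using explorations_outside L c by (intro expectation_count_le_const sum_nonneg) auto
  qed (use t in simp)
  moreover have "1 / t + (k + 2) / t * ?M = (1 + (k + 2) * ?M) / t"
    by (simp only: add_divide_distrib times_divide_eq_left)
  ultimately show ?thesis by linarith
qed

text \<open>A list of length \<open>Suc l\<close> has weight at most \<open>(c / d) ^ Suc l\<close>,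
  while there are only about \<open>d ^ l\<close> such lists up to a constant factor. One factor
  \<open>1 / d\<close> is left over.\<close>

lemma closing_outside:
  fixes L :: nat
  assumes "x \<in> V"
  defines "w \<equiv> 1 + (k + 1) * L"
  defines "A \<equiv> {us \<in> (\<Union>l\<le>L. closing x l). distinct us \<and> set us \<subseteq> U - Z}"
  shows "finite A" "(\<Sum>us\<in>A. \<Prod>u\<in>set us. K u u) \<le> (c * (real w)\<^sup>2 * (\<Sum>l\<le>L. (w * c) ^ l)) / d"
proof -
  have fin: "finite (closing x l)" and card: "card (closing x l) \<le> (w * d) ^ l * w\<^sup>2" if "l \<le> L" for l
    using card_closing_explorations_le[OF assms(1) that] by (auto simp: w_def)
  then have fC: "finite (\<Union>l\<le>L. closing x l)" by auto
  then show fA: "finite A" by (simp add: A_def)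
  have len: "length us = Suc l" if "us \<in> closing x l" for us l using that by (auto simp: closing_def)
  have "(\<Sum>us\<in>A. \<Prod>u\<in>set us. K u u) \<le> (\<Sum>us\<in>A. (c / d) ^ length us)"
    by (intro sum_mono prod_K_le) (auto simp: A_def)
  also have "\<dots> \<le> (\<Sum>us\<in>(\<Union>l\<le>L. closing x l). (c / d) ^ length us)"
    using fC c by (intro sum_mono2) (auto simp: A_def)
  also have "\<dots> = (\<Sum>l\<le>L. \<Sum>us\<in>closing x l. (c / d) ^ length us)"
    \<comment> \<open>The union is disjoint because the length of a list determines
      \<open>l\<close>.\<close>
    using fin len by (intro sum.UNION_disjoint) (auto, metis nat.inject)
  also have "\<dots> = (\<Sum>l\<le>L. card (closing x l) * (c / d) ^ Suc l)"
    by (intro sum.cong) (auto simp: len)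
  also have "\<dots> \<le> (\<Sum>l\<le>L. real ((w * d) ^ l * w\<^sup>2) * (c / d) ^ Suc l)"
    using card c by (intro sum_mono mult_right_mono of_nat_mono) auto
  also have "\<dots> = (\<Sum>l\<le>L. c * (real w)\<^sup>2 / d * (w * c) ^ l)"
  proof (rule sum.cong[OF refl])
    fix l
    have "real ((w * d) ^ l * w\<^sup>2) * (c / d) ^ Suc l = c * (real w)\<^sup>2 / d * (real w * d * (c / d)) ^ l"
    proof -
      have "a * b * v * (c / d * p) = c * v / d * (a * b * p)" for a b v p by simp
      then show ?thesis by (simp only: of_nat_mult of_nat_power power_mult_distrib power_Suc)
    qed
    also have "real w * d * (c / d) = w * c" using d_pos by simp
    finally show "real ((w * d) ^ l * w\<^sup>2) * (c / d) ^ Suc l = c * (real w)\<^sup>2 / d * (w * c) ^ l" .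
  qed
  also have "\<dots> = (c * (real w)\<^sup>2 * (\<Sum>l\<le>L. (w * c) ^ l)) / d" by (simp add: sum_distrib_left sum_divide_distrib)
  finally show "(\<Sum>us\<in>A. \<Prod>u\<in>set us. K u u) \<le> (c * (real w)\<^sup>2 * (\<Sum>l\<le>L. (w * c) ^ l)) / d" .
qed

text \<open>If the ball avoids \<open>Z\<close> and is not a tree, it retains a closing list with at
  most \<open>2 * r\<close> vertices before the closing one. This fixes the choice of
  \<open>w\<close>.\<close>

lemma sample_prob_tree_ge:
  fixes r :: nat
  assumes "V \<noteq> {}"
  defines "w \<equiv> 1 + (k + 1) * (2 * r)"
  shows "1 - sample_prob V U B (\<lambda>S x. is_tree (ball_verts (ind_adj E S) (Inl x) r) (ind_adj E S)) \<le>
    sample_prob V U B (hits r) + (c * (real w)\<^sup>2 * (\<Sum>l\<le>2 * r. (w * c) ^ l)) / d"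
proof -
  let ?A = "\<lambda>x. {us \<in> (\<Union>l\<le>2 * r. closing x l). distinct us \<and> set us \<subseteq> U - Z}"
  let ?X = "\<lambda>S x. real (card {us \<in> ?A x. set us \<subseteq> S})"
  have "sample_prob V U B (\<lambda>S x. \<not> is_tree (ball_verts (ind_adj E S) (Inl x) r) (ind_adj E S)) \<le>
      sample_prob V U B (hits r) + expectation ?X"
  proof (rule sample_prob_le)
    fix S x assume *: "S \<subseteq> U" "x \<in> V" "\<not> hits r S x"
      "\<not> is_tree (ball_verts (ind_adj E S) (Inl x) r) (ind_adj E S)"
    obtain u us where us: "exploration E x (u # us)" "set (u # us) \<subseteq> S" "length us \<le> 2 * r"
      "\<And>w. w \<in> set (u # us) \<Longrightarrow> Inr w \<in> ball_verts (ind_adj E S) (Inl x) r" "closes E x us u"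
      by (rule not_tree_closing_exploration[OF *(4)]) blast
    have "set (u # us) \<subseteq> U - Z" using us(2,4) *(1,3) by blast
    moreover have "u # us \<in> closing x (length us)" using us by (auto simp: closing_def)
    moreover have "distinct (u # us)" using us(1) by (rule exploration_distinct)
    ultimately have "u # us \<in> {us \<in> ?A x. set us \<subseteq> S}" using us(2,3) by blast
    then have "{us \<in> ?A x. set us \<subseteq> S} \<noteq> {}" by blast
    moreover have "finite {us \<in> ?A x. set us \<subseteq> S}" by (rule finite_subset[OF _ closing_outside(1)[OF *(2), of "2 * r"]]) auto
    ultimately have "0 < card {us \<in> ?A x. set us \<subseteq> S}" by (subst card_gt_0_iff) blast
    then show "1 \<le> ?X S x" by linarith
  qed simp
  also have "expectation ?X \<le> (c * (real w)\<^sup>2 * (\<Sum>l\<le>2 * r. (w * c) ^ l)) / d"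
  proof (rule expectation_count_le_const)
    fix x assume "x \<in> V"
    then show "finite (?A x)" by (rule closing_outside(1))
    show "(\<Sum>us\<in>?A x. \<Prod>u\<in>set us. K u u) \<le> (c * (real w)\<^sup>2 * (\<Sum>l\<le>2 * r. (w * c) ^ l)) / d"
      using closing_outside(2)[OF \<open>x \<in> V\<close>, of "2 * r"] by (simp add: w_def)
  qed (use c in \<open>auto intro!: divide_nonneg_nonneg mult_nonneg_nonneg sum_nonneg\<close>)
  finally show ?thesis using sample_prob_not[OF assms(1)] by simp
qed

end
end

section \<open>Convergence\<close>

text \<open>The set \<open>NS\<close> collects the sizes \<open>n\<close> for which a graph is
  given, since biregularity imposes divisibility conditions on \<open>n\<close>. The filter
  \<open>F\<close> lets \<open>n\<close> tend to infinity within \<open>NS\<close>.\<close>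

theorem theorem2p2:
  fixes k :: nat
    and NS :: "nat set"
    and d :: "nat \<Rightarrow> nat"
    and V :: "nat \<Rightarrow> 'v set"
    and U :: "nat \<Rightarrow> 'u set"
    and E :: "nat \<Rightarrow> ('v \<times> 'u) set"
    and B :: "nat \<Rightarrow> 'v \<Rightarrow> 'u \<Rightarrow> real"
    and eps delta :: "nat \<Rightarrow> real"
    and lam :: "nat \<Rightarrow> nat \<Rightarrow> real"
    and psi :: "nat \<Rightarrow> nat \<Rightarrow> 'u \<Rightarrow> real"
    and r :: nat
  defines "F \<equiv> inf sequentially (principal NS)"
  assumes k: "k \<ge> 1"
    and NS: "infinite NS"
    and d_pos: "\<forall>n\<in>NS. d n > 0"
    and d_lim: "filterlim (\<lambda>n. real (d n)) at_top F"
    and V_fin: "\<forall>n\<in>NS. finite (V n) \<and> card (V n) = n"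
    and U_fin: "\<forall>n\<in>NS. finite (U n)"
    and E_sub: "\<forall>n\<in>NS. E n \<subseteq> V n \<times> U n"
    and deg_V: "\<forall>n\<in>NS. \<forall>v\<in>V n. card {u. (v, u) \<in> E n} = d n"
    and deg_U: "\<forall>n\<in>NS. \<forall>u\<in>U n. card {v. (v, u) \<in> E n} = k + 1"
    and C4_V: "\<forall>n\<in>NS. \<forall>v\<in>V n. \<forall>v'\<in>V n. v \<noteq> v' \<longrightarrow>
                 card {u. (v, u) \<in> E n \<and> (v', u) \<in> E n} \<le> 1"
    and C4_U: "\<forall>n\<in>NS. \<forall>u\<in>U n. \<forall>u'\<in>U n. u \<noteq> u' \<longrightarrow>
                 card {v. (v, u) \<in> E n \<and> (v, u') \<in> E n} \<le> 1"
    and B_signed: "\<forall>n\<in>NS. \<forall>v u. (if (v, u) \<in> E n then B n v u \<in> {1, -1} else B n v u = 0)"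
    and eig_pos: "\<forall>n\<in>NS. \<forall>i < mat_rank (V n) (B n). lam n i > 0"
    and eig_vec: "\<forall>n\<in>NS. \<forall>i < mat_rank (V n) (B n). \<forall>u\<in>U n.
                    (\<Sum>w\<in>U n. Lminus (V n) (B n) (d n) u w * psi n i w) = lam n i * psi n i u"
    and eig_orth: "\<forall>n\<in>NS. \<forall>i < mat_rank (V n) (B n). \<forall>j < mat_rank (V n) (B n).
                    ipU (U n) (psi n i) (psi n j) = (if i = j then 1 else 0)"
    and eps_pos: "\<forall>n\<in>NS. eps n > 0"
    and delta_pos: "\<forall>n\<in>NS. delta n > 0"
    and eps_lim: "(eps \<longlongrightarrow> 0) F"
    and eps_d: "filterlim (\<lambda>n. eps n * real (d n)) at_top F"
    and delta_d: "((\<lambda>n. delta n * real (d n)) \<longlongrightarrow> 0) F"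
    and eps_delta_d: "filterlim (\<lambda>n. eps n * delta n * real (d n) ^ 2) at_top F"
    and r: "r > 0"
  shows
    "((\<lambda>t::real. Limsup F (\<lambda>n. ereal (sample_prob (V n) (U n) (B n)
         (\<lambda>T x0. real (card (ball_verts (ind_adj (E n) T) (Inl x0) r)) > t))))
       \<longlongrightarrow> 0) at_top
   \<and> ((\<lambda>n. sample_prob (V n) (U n) (B n)
         (\<lambda>T x0. is_tree (ball_verts (ind_adj (E n) T) (Inl x0) r) (ind_adj (E n) T)))
       \<longlongrightarrow> 1) F
   \<and> ((\<lambda>n. sample_prob (V n) (U n) (B n)
         (\<lambda>T x0. ball_verts (ind_adj (E n) T) (Inl x0) r \<inter>
                 Inr ` structured (U n) (mat_rank (V n) (B n)) (lam n) (psi n) (eps n) (delta n)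
                 \<noteq> {}))
       \<longlongrightarrow> 0) F"
proof -
  \<comment> \<open>Infinitude of \<open>NS\<close> makes the filter proper, which evaluating and
    bounding the upper limit requires.\<close>
  have F_neq_bot: "F \<noteq> bot"
  proof
    assume "F = bot"
    then have "eventually (\<lambda>_. False) F" by simp
    then have "eventually (\<lambda>n. n \<notin> NS) sequentially"
      by (simp add: F_def eventually_inf_principal)
    then obtain m where "\<And>n. n \<ge> m \<Longrightarrow> n \<notin> NS" by (auto simp: eventually_sequentially)
    then have "NS \<subseteq> {..m}" by (meson atMost_iff nat_le_linear subsetI)
    then show False using NS finite_subset by blast
  qed
  have ev_NS: "eventually (\<lambda>n. n \<in> NS) F" by (simp add: F_def eventually_inf_principal)
  have ev_pos: "eventually (\<lambda>n. n > 0) F"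
    unfolding F_def eventually_inf_principal using eventually_gt_at_top[of 0]
    by (rule eventually_mono) simp
  have ev_eps: "eventually (\<lambda>n. eps n \<le> 1 / 4) F"
    using order_tendstoD(2)[OF eps_lim, of "1 / 4"] by (auto elim: eventually_mono)
  have ev_delta: "eventually (\<lambda>n. delta n * real (d n) \<le> 1) F"
    using order_tendstoD(2)[OF delta_d, of 1] by (auto elim: eventually_mono)

  let ?c = "real (2 * k + 3)"
  define w where "w = 1 + (k + 1) * (2 * r)"
  \<comment> \<open>The mass of the structured vertices per vertex of \<open>V\<close>, from
    \<open>sum_K_structured\<close>. The constants \<open>Mh\<close>, \<open>Mb\<close> and
    \<open>Mt\<close> below do not depend on \<open>n\<close>.\<close>
  define \<beta> where "\<beta> n = real (2 * k * (k + 1)) / (eps n * delta n * real (d n) ^ 2) + real k / (eps n * real (d n))" for n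
  define Mh where "Mh = (\<Sum>l<r. real (k + 1) * (real (k + 1) * ?c) ^ l)"
  define Mb where "Mb = 1 + real (k + 2) * (\<Sum>l\<le>r. (real w * ?c) ^ l)"
  define Mt where "Mt = ?c * (real w)\<^sup>2 * (\<Sum>l\<le>2 * r. (real w * ?c) ^ l)"
  let ?Z = "\<lambda>n. structured (U n) (mat_rank (V n) (B n)) (lam n) (psi n) (eps n) (delta n)"
  let ?big = "\<lambda>t n. sample_prob (V n) (U n) (B n)
    (\<lambda>T x0. real (card (ball_verts (ind_adj (E n) T) (Inl x0) r)) > t)"
  let ?tree = "\<lambda>n. sample_prob (V n) (U n) (B n)
    (\<lambda>T x0. is_tree (ball_verts (ind_adj (E n) T) (Inl x0) r) (ind_adj (E n) T))"
  let ?hit = "\<lambda>n. sample_prob (V n) (U n) (B n)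
    (\<lambda>T x0. ball_verts (ind_adj (E n) T) (Inl x0) r \<inter> Inr ` ?Z n \<noteq> {})"

  have eig: "signed_biregular_eig k (d n) (V n) (U n) (E n) (B n) (lam n) (psi n)" if "n \<in> NS" for n
  proof unfold_locales
    show "d n > 0" "finite (V n)" "finite (U n)" "E n \<subseteq> V n \<times> U n"
      using that d_pos V_fin U_fin E_sub by simp_all
    show "card {u. (v, u) \<in> E n} = d n" if "v \<in> V n" for v using \<open>n \<in> NS\<close> deg_V that by blast
    show "card {v. (v, u) \<in> E n} = k + 1" if "u \<in> U n" for u using \<open>n \<in> NS\<close> deg_U that by blast
    show "card {u. (v, u) \<in> E n \<and> (v', u) \<in> E n} \<le> 1" if "v \<in> V n" "v' \<in> V n" "v \<noteq> v'" for v v'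
      using \<open>n \<in> NS\<close> C4_V that by blast
    show "card {v. (v, u) \<in> E n \<and> (v, u') \<in> E n} \<le> 1" if "u \<in> U n" "u' \<in> U n" "u \<noteq> u'" for u u'
      using \<open>n \<in> NS\<close> C4_U that by blast
    show "if (v, u) \<in> E n then B n v u \<in> {1, - 1} else B n v u = 0" for v u
      using \<open>n \<in> NS\<close> B_signed by blast
    show "lam n i > 0" if "i < mat_rank (V n) (B n)" for i using \<open>n \<in> NS\<close> eig_pos that by blast
    show "(\<Sum>w\<in>U n. Lminus (V n) (B n) (d n) u w * psi n i w) = lam n i * psi n i u"
      if "i < mat_rank (V n) (B n)" "u \<in> U n" for i u using \<open>n \<in> NS\<close> eig_vec that by blast
    show "ipU (U n) (psi n i) (psi n j) = (if i = j then 1 else 0)"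
      if "i < mat_rank (V n) (B n)" "j < mat_rank (V n) (B n)" for i j
      using \<open>n \<in> NS\<close> eig_orth that by blast
  qed
  have nonneg: "sample_prob (V n) (U n) (B n) P \<ge> 0" if "n \<in> NS" for n P
    using signed_biregular_eig.sample_prob_nonneg[OF eig[OF that]] .

  \<comment> \<open>All estimates for a single graph. The hypotheses on \<open>eps n\<close> and
    \<open>delta n\<close> hold eventually, and \<open>n > 0\<close> ensures that a root
    exists.\<close>
  have bounds: "?hit n \<le> \<beta> n * Mh \<and> (\<forall>t>0. ?big t n \<le> \<beta> n * Mh + Mb / t) \<and>
      1 - ?tree n \<le> \<beta> n * Mh + Mt / real (d n) \<and> ?tree n \<le> 1"
    if n: "n \<in> NS" "n > 0" "eps n \<le> 1 / 4" "delta n * real (d n) \<le> 1" for n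
  proof -
    interpret signed_biregular_eig k "d n" "V n" "U n" "E n" "B n" "lam n" "psi n"
      using n(1) by (rule eig)
    have pos: "eps n > 0" "delta n > 0" using eps_pos delta_pos n(1) by auto
    have Z: "?Z n \<subseteq> U n" by (auto simp: structured_def)
    have c: "?c \<ge> 0" by simp
    have K_le: "K u u \<le> ?c / real (d n)" if "u \<in> U n - ?Z n" for u
      using K_diag_unstructured[OF pos(1) n(3) pos(2) n(4) that] by simp
    have K_Z: "(\<Sum>u\<in>?Z n. K u u) \<le> real (card (V n)) * \<beta> n"
      using sum_K_structured[OF pos(1) n(3) pos(2) n(4)] by (simp add: \<beta>_def)
    have \<beta>: "\<beta> n \<ge> 0" using pos by (simp add: \<beta>_def)
    have V: "V n \<noteq> {}" using V_fin n(1,2) by auto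
    note hyps = Z c K_le K_Z \<beta>
    have hit: "?hit n \<le> \<beta> n * Mh"
      using sample_prob_hits_le[OF hyps, of r] by (simp add: Mh_def)
    have big: "?big t n \<le> \<beta> n * Mh + Mb / t" if "t > 0" for t
      using sample_prob_large_ball_le[OF hyps that, of r "2 * r"] hit
      by (simp add: Mb_def w_def)
    have "1 - ?tree n \<le> \<beta> n * Mh + Mt / real (d n)"
      using sample_prob_tree_ge[OF hyps V, of r] hit by (simp add: Mt_def w_def)
    moreover have "?tree n \<le> 1"
      using sample_prob_not[OF V, of "\<lambda>T x0. is_tree (ball_verts (ind_adj (E n) T) (Inl x0) r) (ind_adj (E n) T)"]
        sample_prob_nonneg[of "\<lambda>T x0. \<not> is_tree (ball_verts (ind_adj (E n) T) (Inl x0) r) (ind_adj (E n) T)"]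
      by linarith
    ultimately show ?thesis using hit big by blast
  qed
  have ev_bounds: "eventually (\<lambda>n. ?hit n \<le> \<beta> n * Mh \<and> (\<forall>t>0. ?big t n \<le> \<beta> n * Mh + Mb / t) \<and>
      1 - ?tree n \<le> \<beta> n * Mh + Mt / real (d n) \<and> ?tree n \<le> 1) F"
    using ev_NS ev_pos ev_eps ev_delta by eventually_elim (rule bounds)

  have \<beta>_lim: "(\<beta> \<longlongrightarrow> 0) F"
  proof -
    have "((\<lambda>n. real (2 * k * (k + 1)) / (eps n * delta n * real (d n) ^ 2) + real k / (eps n * real (d n))) \<longlongrightarrow> 0 + 0) F"
      \<comment> \<open>The two summands vanish by the divergence of
        \<open>eps n * delta n * d n ^ 2\<close> and of \<open>eps n * d n\<close>
        respectively.\<close>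
      by (intro tendsto_add tendsto_divide_0[OF tendsto_const] filterlim_at_top_imp_at_infinity eps_d eps_delta_d)
    then show ?thesis by (simp add: \<beta>_def[abs_def])
  qed
  have \<beta>M_lim: "((\<lambda>n. \<beta> n * Mh) \<longlongrightarrow> 0) F"
    using tendsto_mult_right[OF \<beta>_lim, of Mh] by simp
  have d_lim': "((\<lambda>n. Mt / real (d n)) \<longlongrightarrow> 0) F"
    by (intro tendsto_divide_0[OF tendsto_const] filterlim_at_top_imp_at_infinity d_lim)

  have part3: "(?hit \<longlongrightarrow> 0) F"
  proof (rule tendsto_sandwich[OF _ _ tendsto_const \<beta>M_lim])
    show "eventually (\<lambda>n. 0 \<le> ?hit n) F" using ev_NS by eventually_elim (rule nonneg)
    show "eventually (\<lambda>n. ?hit n \<le> \<beta> n * Mh) F" using ev_bounds by eventually_elim blast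
  qed

  have part2: "(?tree \<longlongrightarrow> 1) F"
  proof (rule tendsto_sandwich[OF _ _ _ tendsto_const])
    show "((\<lambda>n. 1 - (\<beta> n * Mh + Mt / real (d n))) \<longlongrightarrow> 1) F"
      using tendsto_diff[OF tendsto_const tendsto_add[OF \<beta>M_lim d_lim'], of 1] by simp
    show "eventually (\<lambda>n. 1 - (\<beta> n * Mh + Mt / real (d n)) \<le> ?tree n) F"
      using ev_bounds by eventually_elim linarith
    show "eventually (\<lambda>n. ?tree n \<le> 1) F" using ev_bounds by eventually_elim blast
  qed

  \<comment> \<open>For fixed \<open>t\<close> the limit in \<open>n\<close> removes the
    contribution of structured vertices; the remaining Markov term \<open>Mb / t\<close> vanishes as
    \<open>t\<close> grows.\<close>
  have Limsup_le: "Limsup F (\<lambda>n. ereal (?big t n)) \<le> ereal (Mb / t)" if t: "t > 0" for t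
  proof -
    have "Limsup F (\<lambda>n. ereal (?big t n)) \<le> Limsup F (\<lambda>n. ereal (\<beta> n * Mh + Mb / t))"
    proof (rule Limsup_mono)
      show "eventually (\<lambda>n. ereal (?big t n) \<le> ereal (\<beta> n * Mh + Mb / t)) F"
        using ev_bounds by eventually_elim (use t in simp)
    qed
    also have "((\<lambda>n. ereal (\<beta> n * Mh + Mb / t)) \<longlongrightarrow> ereal (Mb / t)) F"
      using tendsto_add[OF \<beta>M_lim tendsto_const[of "Mb / t"]] by (simp add: tendsto_ereal)
    then have "Limsup F (\<lambda>n. ereal (\<beta> n * Mh + Mb / t)) = ereal (Mb / t)"
      using F_neq_bot by (intro lim_imp_Limsup)
    finally show ?thesis .
  qed
  have part1: "((\<lambda>t::real. Limsup F (\<lambda>n. ereal (?big t n))) \<longlongrightarrow> 0) at_top"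
  proof (rule tendsto_sandwich[OF _ _ tendsto_const])
    show "((\<lambda>t. ereal (Mb / t)) \<longlongrightarrow> 0) at_top"
    proof -
      have "((\<lambda>t. Mb / t) \<longlongrightarrow> 0) at_top"
        by (intro tendsto_divide_0[OF tendsto_const] filterlim_at_top_imp_at_infinity filterlim_ident)
      then show ?thesis using tendsto_ereal by (fastforce simp: zero_ereal_def)
    qed
    show "eventually (\<lambda>t. 0 \<le> Limsup F (\<lambda>n. ereal (?big t n))) at_top"
    proof (rule always_eventually, intro allI le_Limsup)
      show "eventually (\<lambda>n. 0 \<le> ereal (?big t n)) F" for t
        using ev_NS by eventually_elim (simp add: nonneg)
    qed (rule F_neq_bot)
    show "eventually (\<lambda>t. Limsup F (\<lambda>n. ereal (?big t n)) \<le> ereal (Mb / t)) at_top"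
      using eventually_gt_at_top[of "0::real"] by eventually_elim (rule Limsup_le)
  qed
  show ?thesis using part1 part2 part3 by blast
qed

end
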